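(* Let $\mathcal{G}=(\mathcal{V},\mathcal{E})$, $\mathcal{V}=\{1,\dots,n\}$, be a strongly connected digraph, and let $f_1,\dots,f_n:\mathbb{R}^p\to\mathbb{R}$ be differentiable functions such that, for some constants $\mu,L>0$, for every $i\in\mathcal{V}$ and all $\mathbf{x},\mathbf{y}\in\mathbb{R}^p$, $$\langle\nabla f_i(\mathbf{x})-\nabla f_i(\mathbf{y}),\mathbf{x}-\mathbf{y}\rangle\ge\mu\|\mathbf{x}-\mathbf{y}\|^2,\qquad \|\nabla f_i(\mathbf{x})-\nabla f_i(\mathbf{y})\|\le L\|\mathbf{x}-\mathbf{y}\|.$$ Let $x^\star\in\mathbb{R}^p$ be the unique minimizer of $F(x)=\sum_{i=1}^n f_i(x)$. Let PrFTPS and PrFTPS-GD be the algorithms described in the context, run from non-exceptional initial conditions (as defined in the context). Then: 1) PrFTPS, run with initial states $x_1(0),\dots,x_n(0)$, outputs at every node the exact average of the initial values of all nodes: $$\hat x_j^{ave}=\frac1n\sum_{i\in\mathcal{V}}x_i(0)\qquad\forall j\in\mathcal{V}.$$ 2) If the stepsize satisfies $0<\eta<\frac{1}{\mu+L}$, then the iterates $\bm{x}(t)=[x_1(t)^\top,\dots,x_n(t)^\top]^\top\in\mathbb{R}^{np}$ of PrFTPS-GD converge linearly, with respect to the optimization iteration number $t$, to the global optimum: $\|\bm{x}(t)-\mathbf{1}_n\otimes x^\star\|_2$ converges to $0$ linearly, i.e. there exist $C\ge 0$ and $\lambda\in(0,1)$ with $\|\bm{x}(t)-\mathbf{1}_n\otimes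 x^\star\|_2\le C\lambda^t$ for all $t\ge0$.
   Context: **Graph notation.** An edge $\varepsilon_{ji}=(j,i)\in\mathcal{E}$ means node $i$ can send messages to node $j$. $N_i^-=\{j\in\mathcal{V}:\varepsilon_{ij}\in\mathcal{E}\}$ is the set of in-neighbours, $N_i^+=\{j\in\mathcal{V}:\varepsilon_{ji}\in\mathcal{E}\}$ the set of out-neighbours, $\mathcal{D}_i^+=|N_i^+|$. $\mathbf{1}_n$ is the all-ones vector and $\otimes$ the Kronecker product. **State-decomposition iteration.** Each node $i$ has a real initial state $x_i(0)$ (vector states are treated componentwise). For $l=1,2$ it keeps two substates $x^\alpha_{i,l}(k)$ and $x^\beta_{i,l}(k)$. The initial values are arbitrary reals subject to $x_{i,1}^\alpha(0)+x_{i,1}^\beta(0)=2x_i(0)$, $x_{i,2}^\alpha(0)=0$, $x_{i,2}^\beta(0)=2$. For $k\ge0$, $$x_{i,l}^\alpha(k+1)=\sum_{j\in N_i^-\cup\{i\}}p_{ij}(k)x_{j,l}^\alpha(k)+a_i^{\alpha,\beta}(k)x_{i,l}^\beta(k),\qquad x_{i,l}^\beta(k+1)=a_i^{\beta,\alpha}(k)x_{i,l}^\alpha(k)+a_i^{\beta,\beta}(k)x_{i,l}^\beta(k).$$ Weights at $k=0$: $a_i^{\beta,\beta}(0)=0$, $a_i^{\alpha,\beta}(0)=1$, $p_{ji}(0)=0$ for $j\notin N_i^+\cup\{i\}$, and $p_{ji}(0)$ ($j\in N_i^+\cup\{i\}$) and $a_i^{\beta,\alpha}(0)$ are arbitrary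 reals with $\sum_{j=1}^np_{ji}(0)+a_i^{\beta,\alpha}(0)=1$. Weights at $k\ge1$: $p_{ji}(k)=\frac1{2+\mathcal{D}_i^+}$ for $j\in N_i^+\cup\{i\}$ and $0$ otherwise, $a_i^{\beta,\alpha}(k)=\frac1{2+\mathcal{D}_i^+}$, $a_i^{\beta,\beta}(k)=a_i^{\alpha,\beta}(k)=\frac12$. Hence for $k\ge1$ the stacked vector $\bm{x_l}(k)=[x_{1,l}^\alpha(k),\dots,x_{n,l}^\alpha(k),x_{1,l}^\beta(k),\dots,x_{n,l}^\beta(k)]^\top$ satisfies $\bm{x_l}(k+1)=\bm{\hat P}\bm{x_l}(k)$ with the constant matrix $$\bm{\hat P}=\begin{bmatrix}\bm{P}&\frac12\bm{I}_n\\ \bm{\Lambda}&\frac12\bm{I}_n\end{bmatrix},\qquad \bm{P}=[p_{ij}(1)],\quad \bm{\Lambda}=\mathrm{diag}(a_1^{\beta,\alpha}(1),\dots,a_n^{\beta,\alpha}(1)).$$ **Minimal polynomial data.** For $j\in\mathcal{V}$, $Q_j(t)=t^{D_j+1}+\sum_{i=0}^{D_j}\alpha_{j,i}t^i$ is the monic real polynomial of minimum degree $D_j+1$ with $e_j^\top Q_j(\bm{\hat P})=0$ ($e_j$ the $j$th standard basis vector of $\mathbb{R}^{2n}$). Put $p_j(z)=Q_j(z)/(z-1)=\sum_{i=0}^{D_j}\beta^{(j)}_iz^i$ and $\bm{\beta}_j=(\beta_0^{(j)},\dots,\beta_{D_j}^{(j)})^\top$. Put $(x^\alpha_{l,D_j})^\top=(x^\alpha_{j,l}(1),x^\alpha_{j,l}(2),\dots,x^\alpha_{j,l}(D_j+1))$.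 **Algorithm PrFTPS (input: states $x_j(0)$ and an optimization step index $t\ge0$; for part 1, $t=0$ may be taken, or $t\ge1$ after a run with $t=0$).** - If $t=0$: the nodes run the iteration above. Let $(\bar x_{l,2k}^\alpha)^\top=(x_{j,l}^\alpha(2)-x_{j,l}^\alpha(1),\dots,x_{j,l}^\alpha(2k+2)-x_{j,l}^\alpha(2k+1))$ and let $\Gamma\{\cdot\}$ be the $(k+1)\times(k+1)$ Hankel matrix built from these $2k+1$ numbers. Node $j$ increases $k$ until the Hankel matrices $\Gamma\{(\bar x^\alpha_{1,2k})^\top\}$ and $\Gamma\{(\bar x^\alpha_{2,2k})^\top\}$ lose rank, and stores the kernel vector of the first defective matrix as $\bm{\beta}_j$ (determined up to a nonzero scalar, which does not affect the output below). Termination: alongside, each node keeps a counter $c_j$ (starting from $0$, incremented at each time step, and frozen at $c_j^o=2(D_j+1)+1$ when its Hankel matrices lose rank), runs the max-consensus $\theta_j(k+1)=\max_{i\in N_j^-\cup\{j\}}\max\{\theta_i(k),c_i(k)\}$, $\theta_j(0)=0$, and a counter $r_j$ with $r_j(0)=0$, $r_j(k+1)=0$ if $\theta_j(k+1)\ne\theta_j(k)$ and $r_j(k+1)=r_j(k)+1$ otherwise. Node $j$ stops at the iteration $k_{j,t}$ at which $r_j=c_j^o$, and stores $D_{\max}=\frac{k_{j,t}-2D_j-2}{2}-1$. - If $t\ge1$: the nodes run the iteration above (from the new input states) for $D_{\max}+2$ steps and reuse the stored $\bm{\beta}_j$. - Output at node $j$: $\hat x_j^{ave}=\dfrac{(x^\alpha_{1,D_j})^\top\bm{\beta}_j}{(x^\alpha_{2,D_j})^\top\bm{\beta}_j}$.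 **Non-exceptional initial conditions.** The kernel computation at $t=0$ recovers the coefficient vector of $p_j$ except for an exceptional set of initial conditions $x_{j,1}^\alpha(1),x_{j,2}^\alpha(1)$ of Lebesgue measure zero. "Non-exceptional" means outside this set, i.e. the vector stored by each node $j$ at $t=0$ is, up to a nonzero scalar, the coefficient vector $\bm{\beta}_j$ of $p_j$. **Algorithm PrFTPS-GD.** Let $\mathbf{\bar A}=[\bar a_{ij}]\in\mathbb{R}^{n\times n}$ be a row-stochastic matrix (nonnegative entries, each row sums to $1$), with $\bar a_{ij}=0$ for $j\notin N_i^-\cup\{i\}$. Starting from arbitrary $x_i(0)\in\mathbb{R}^p$, for $t=0,1,2,\dots$: (i) the nodes run PrFTPS componentwise with input state $\nabla f_i(x_i(t))$ at node $i$ and step index $t$; $y_i(t)\in\mathbb{R}^p$ denotes the output at node $i$; (ii) $x_i(t+1)=\sum_{j\in N_i^-\cup\{i\}}\bar a_{ij}x_j(t)-\eta\,y_i(t)$, where $\eta>0$ is the stepsize. Equivalently $\bm{x}(t+1)=(\mathbf{\bar A}\otimes\mathbf{I}_p)\bm{x}(t)-\eta\bm{y}(t)$ with $\bm{y}(t)=[y_1(t)^\top,\dots,y_n(t)^\top]^\top$.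
   Formalization: Part 2 additionally assumes that some power of the row-stochastic matrix Ā has a strictly positive column (it fails for Ā = I: with n=2, f_i=x²/2, x(0)=(1,−1) the iterates stay constant); the digraph has no self-loops, as the stated weights require. *)

theory Defs
  imports
    "Jordan_Normal_Form.DL_Rank"
    "Jordan_Normal_Form.Matrix_Kernel"
    "HOL-Computational_Algebra.Polynomial"
    "HOL-Analysis.Analysis"
begin

text \<open>
  Nodes form a finite type, and (j, i) in E means that i can send messages to j.
  Fixed-size matrices and vectors come from HOL-Analysis; the Jordan_Normal_Form matrices are
  used only for the Hankel matrices, whose size grows during the run.
\<close>

no_notation Matrix.vec_index (infixl "$" 100)

section \<open>Digraphs and weights\<close>

definition in_nbrs :: "'n rel \<Rightarrow> 'n \<Rightarrow> 'n set" where
  "in_nbrs E i = {j. (i, j) \<in> E}"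

definition out_nbrs :: "'n rel \<Rightarrow> 'n \<Rightarrow> 'n set" where
  "out_nbrs E i = {j. (j, i) \<in> E}"

definition out_deg :: "'n rel \<Rightarrow> 'n \<Rightarrow> nat" where
  "out_deg E i = card (out_nbrs E i)"

text \<open>Self-loops are excluded: otherwise the columns of the matrix \<open>P_hat\<close> below do not sum to 1.\<close>

definition strongly_connected_digraph :: "'n rel \<Rightarrow> bool" where
  "strongly_connected_digraph E \<longleftrightarrow> irrefl E \<and> (\<forall>i j. (i, j) \<in> E\<^sup>*)"

text \<open>The free choices of one run: the weights at time 0 and the initial substates
  \<open>x\<^sup>\<alpha>\<^sub>i\<^sub>,\<^sub>l(0)\<close>, \<open>x\<^sup>\<beta>\<^sub>i\<^sub>,\<^sub>l(0)\<close>, indexed as \<open>init_alpha R l i\<close>, \<open>init_beta R l i\<close> with \<open>l\<close> in \<open>{1, 2}\<close>.\<close>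

record 'n run =
  init_p :: "'n \<Rightarrow> 'n \<Rightarrow> real"
  init_a :: "'n \<Rightarrow> real"
  init_alpha :: "nat \<Rightarrow> 'n \<Rightarrow> real"
  init_beta :: "nat \<Rightarrow> 'n \<Rightarrow> real"

definition valid_run :: "('n::finite) rel \<Rightarrow> ('n \<Rightarrow> real) \<Rightarrow> 'n run \<Rightarrow> bool" where
  "valid_run E s R \<longleftrightarrow>
     (\<forall>i j. j \<notin> out_nbrs E i \<union> {i} \<longrightarrow> init_p R j i = 0) \<and>
     (\<forall>i. (\<Sum>j\<in>UNIV. init_p R j i) + init_a R i = 1) \<and>
     (\<forall>i. init_alpha R 1 i + init_beta R 1 i = 2 * s i) \<and>
     (\<forall>i. init_alpha R 2 i = 0 \<and> init_beta R 2 i = 2)"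

definition p_const :: "'n rel \<Rightarrow> 'n \<Rightarrow> 'n \<Rightarrow> real" where
  "p_const E j i = (if j \<in> out_nbrs E i \<union> {i} then 1 / (2 + real (out_deg E i)) else 0)"

definition a_const :: "'n rel \<Rightarrow> 'n \<Rightarrow> real" where
  "a_const E i = 1 / (2 + real (out_deg E i))"

definition weight_p :: "'n rel \<Rightarrow> 'n run \<Rightarrow> nat \<Rightarrow> 'n \<Rightarrow> 'n \<Rightarrow> real" where
  "weight_p E R k = (if k = 0 then init_p R else p_const E)"

definition weight_ba :: "'n rel \<Rightarrow> 'n run \<Rightarrow> nat \<Rightarrow> 'n \<Rightarrow> real" where
  "weight_ba E R k = (if k = 0 then init_a R else a_const E)"

definition weight_ab :: "nat \<Rightarrow> real" where
  "weight_ab k = (if k = 0 then 1 else 1 / 2)"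

definition weight_bb :: "nat \<Rightarrow> real" where
  "weight_bb k = (if k = 0 then 0 else 1 / 2)"

section \<open>State-decomposition iteration\<close>

fun x_alpha :: "'n rel \<Rightarrow> 'n run \<Rightarrow> nat \<Rightarrow> nat \<Rightarrow> 'n \<Rightarrow> real"
  and x_beta :: "'n rel \<Rightarrow> 'n run \<Rightarrow> nat \<Rightarrow> nat \<Rightarrow> 'n \<Rightarrow> real" where
  "x_alpha E R l 0 i = init_alpha R l i"
| "x_alpha E R l (Suc k) i =
     (\<Sum>j\<in>in_nbrs E i \<union> {i}. weight_p E R k i j * x_alpha E R l k j)
     + weight_ab k * x_beta E R l k i"
| "x_beta E R l 0 i = init_beta R l i"
| "x_beta E R l (Suc k) i =
     weight_ba E R k i * x_alpha E R l k i + weight_bb k * x_beta E R l k i"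

section \<open>Minimal polynomial data\<close>

primrec matpow :: "real^'m^'m \<Rightarrow> nat \<Rightarrow> real^('m::finite)^'m" where
  "matpow A 0 = Finite_Cartesian_Product.mat 1"
| "matpow A (Suc k) = A ** matpow A k"

definition poly_mat :: "real poly \<Rightarrow> real^'m^'m \<Rightarrow> real^('m::finite)^'m" where
  "poly_mat q A = (\<Sum>i\<le>degree q. coeff q i *\<^sub>R matpow A i)"

text \<open>Index \<open>Inl i\<close> is the alpha-substate of node \<open>i\<close>, index \<open>Inr i\<close> its beta-substate.\<close>

definition P_hat :: "('n::finite) rel \<Rightarrow> real^('n + 'n)^('n + 'n)" where
  "P_hat E = (\<chi> r c. case (r, c) of
       (Inl i, Inl j) \<Rightarrow> p_const E i j
     | (Inl i, Inr j) \<Rightarrow> if i = j then 1 / 2 else 0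
     | (Inr i, Inl j) \<Rightarrow> if i = j then a_const E i else 0
     | (Inr i, Inr j) \<Rightarrow> if i = j then 1 / 2 else 0)"

definition annihilates :: "('n::finite) rel \<Rightarrow> 'n \<Rightarrow> real poly \<Rightarrow> bool" where
  "annihilates E j q \<longleftrightarrow> axis (Inl j) 1 v* poly_mat q (P_hat E) = 0"

definition Q_poly :: "('n::finite) rel \<Rightarrow> 'n \<Rightarrow> real poly" where
  "Q_poly E j = (THE q. lead_coeff q = 1 \<and> annihilates E j q \<and>
     (\<forall>q'. lead_coeff q' = 1 \<and> annihilates E j q' \<longrightarrow> degree q \<le> degree q'))"

definition p_poly :: "('n::finite) rel \<Rightarrow> 'n \<Rightarrow> real poly" where
  "p_poly E j = Q_poly E j div [:-1, 1:]"

definition beta_vec :: "('n::finite) rel \<Rightarrow> 'n \<Rightarrow> real Matrix.vec" where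
  "beta_vec E j = Matrix.vec (degree (p_poly E j) + 1) (coeff (p_poly E j))"

section \<open>Algorithm PrFTPS\<close>

definition hankel :: "(nat \<Rightarrow> real) \<Rightarrow> nat \<Rightarrow> real Matrix.mat" where
  "hankel d k = Matrix.mat (k + 1) (k + 1) (\<lambda>(r, c). d (r + c))"

definition loses_rank :: "real Matrix.mat \<Rightarrow> bool" where
  "loses_rank M \<longleftrightarrow> vec_space.rank (dim_row M) M < dim_row M"

definition diff_seq :: "'n rel \<Rightarrow> 'n run \<Rightarrow> nat \<Rightarrow> 'n \<Rightarrow> nat \<Rightarrow> real" where
  "diff_seq E R l j m = x_alpha E R l (m + 2) j - x_alpha E R l (m + 1) j"

text \<open>Both matrices must be defective. The sequence for \<open>l = 2\<close> starts from fixed data and, on a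
  symmetric graph such as a complete one, loses rank too early for every choice of initial values.\<close>

definition defect_index :: "'n rel \<Rightarrow> 'n run \<Rightarrow> 'n \<Rightarrow> nat" where
  "defect_index E R j = (LEAST k. \<forall>l\<in>{1, 2}. loses_rank (hankel (diff_seq E R l j) k))"

text \<open>The kernel vector may be taken from either of the two Hankel matrices.\<close>

definition stored_vector :: "'n rel \<Rightarrow> 'n run \<Rightarrow> 'n \<Rightarrow> real Matrix.vec \<Rightarrow> bool" where
  "stored_vector E R j b \<longleftrightarrow>
     (\<exists>l\<in>{1, 2}. b \<in> mat_kernel (hankel (diff_seq E R l j) (defect_index E R j))) \<and>
     b \<noteq> 0\<^sub>v (dim_vec b)"

definition non_exceptional :: "('n::finite) rel \<Rightarrow> ('n \<Rightarrow> real Matrix.vec) \<Rightarrow> bool" where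
  "non_exceptional E b \<longleftrightarrow> (\<forall>j. \<exists>c. c \<noteq> 0 \<and> b j = c \<cdot>\<^sub>v beta_vec E j)"

definition c_frozen :: "'n rel \<Rightarrow> 'n run \<Rightarrow> 'n \<Rightarrow> nat" where
  "c_frozen E R j = 2 * (defect_index E R j + 1) + 1"

definition c_count :: "'n rel \<Rightarrow> 'n run \<Rightarrow> nat \<Rightarrow> 'n \<Rightarrow> nat" where
  "c_count E R k j = min k (c_frozen E R j)"

primrec theta :: "'n rel \<Rightarrow> 'n run \<Rightarrow> nat \<Rightarrow> 'n \<Rightarrow> nat" where
  "theta E R 0 = (\<lambda>j. 0)"
| "theta E R (Suc k) =
     (\<lambda>j. Max ((\<lambda>i. max (theta E R k i) (c_count E R k i)) ` (in_nbrs E j \<union> {j})))"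

primrec r_count :: "'n rel \<Rightarrow> 'n run \<Rightarrow> nat \<Rightarrow> 'n \<Rightarrow> nat" where
  "r_count E R 0 = (\<lambda>j. 0)"
| "r_count E R (Suc k) =
     (\<lambda>j. if theta E R (Suc k) j \<noteq> theta E R k j then 0 else r_count E R k j + 1)"

definition stop_time :: "'n rel \<Rightarrow> 'n run \<Rightarrow> 'n \<Rightarrow> nat" where
  "stop_time E R j = (LEAST k. r_count E R k j = c_frozen E R j)"

definition D_max :: "'n rel \<Rightarrow> 'n run \<Rightarrow> 'n \<Rightarrow> real" where
  "D_max E R j = (real (stop_time E R j) - 2 * real (defect_index E R j) - 2) / 2 - 1"

definition ratio :: "'n rel \<Rightarrow> 'n run \<Rightarrow> real Matrix.vec \<Rightarrow> 'n \<Rightarrow> real" where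
  "ratio E R b j =
     scalar_prod (Matrix.vec (dim_vec b) (\<lambda>m. x_alpha E R 1 (m + 1) j)) b /
     scalar_prod (Matrix.vec (dim_vec b) (\<lambda>m. x_alpha E R 2 (m + 1) j)) b"

text \<open>\<open>Rs t\<close> is the run executed at optimization step \<open>t\<close>, \<open>s t\<close> its input states and \<open>b j\<close> the
  vector that node \<open>j\<close> stores at step 0.\<close>

definition prftps_execution ::
    "('n::finite) rel \<Rightarrow> (nat \<Rightarrow> 'n \<Rightarrow> real) \<Rightarrow> (nat \<Rightarrow> 'n run) \<Rightarrow> ('n \<Rightarrow> real Matrix.vec) \<Rightarrow> bool" where
  "prftps_execution E s Rs b \<longleftrightarrow>
     (\<forall>t. valid_run E (s t) (Rs t)) \<and> (\<forall>j. stored_vector E (Rs 0) j (b j))"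

text \<open>The output at node \<open>j\<close>. It is \<open>None\<close> unless all nodes stop at step 0 and no node stops before
  the samples needed by node \<open>j\<close> have been produced: the Hankel matrices with kernel vector \<open>b j\<close>
  use times up to \<open>2 * dim_vec (b j)\<close>, the output formula uses times up to \<open>dim_vec (b j)\<close>.\<close>

definition prftps ::
    "'n rel \<Rightarrow> (nat \<Rightarrow> 'n run) \<Rightarrow> ('n \<Rightarrow> real Matrix.vec) \<Rightarrow> nat \<Rightarrow> 'n \<Rightarrow> real option" where
  "prftps E Rs b t j =
     (if (\<forall>i. \<exists>k. r_count E (Rs 0) k i = c_frozen E (Rs 0) i) \<and>
         (if t = 0 then \<forall>i. 2 * dim_vec (b j) \<le> stop_time E (Rs 0) i
          else \<forall>i. real (dim_vec (b j)) \<le> D_max E (Rs 0) i + 2)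
      then Some (ratio E (Rs t) (b j) j) else None)"

section \<open>Algorithm PrFTPS-GD\<close>

definition row_stochastic_on :: "('n::finite) rel \<Rightarrow> real^'n^'n \<Rightarrow> bool" where
  "row_stochastic_on E A \<longleftrightarrow>
     (\<forall>i j. 0 \<le> A $ i $ j) \<and> (\<forall>i. (\<Sum>j\<in>UNIV. A $ i $ j) = 1) \<and>
     (\<forall>i j. j \<notin> in_nbrs E i \<union> {i} \<longrightarrow> A $ i $ j = 0)"

text \<open>
  Since all nodes subtract the same gradient average, the differences of their iterates evolve by
  \<open>A\<close> alone, and for \<open>A\<close> the identity they are constant. So row-stochasticity must be complemented
  by a condition under which the powers of \<open>A\<close> tend to a matrix with equal rows. For a
  row-stochastic matrix this happens iff some power has a positive column (A is SIA: stochastic,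
  indecomposable, aperiodic). Lemma \<open>SIA_of_positive_weights\<close> covers the usual weights, positive
  exactly on the in-neighbours and the node itself.
\<close>

definition SIA :: "real^'n^'n \<Rightarrow> bool" where
  "SIA A \<longleftrightarrow> (\<exists>m j. \<forall>i. 0 < matpow A m $ i $ (j::'n::finite))"

lemma SIA_of_positive_weights:
  fixes A :: "real^('n::finite)^'n"
  assumes E: "strongly_connected_digraph E"
    and nonneg: "\<And>i j. 0 \<le> A $ i $ j"
    and pos: "\<And>i j. j \<in> in_nbrs E i \<union> {i} \<Longrightarrow> 0 < A $ i $ j"
  shows "SIA A"
proof -
  have step_eq: "matpow A (Suc m) $ i $ j = (\<Sum>k\<in>UNIV. A $ i $ k * matpow A m $ k $ j)" for m i j
    by (simp add: matrix_matrix_mult_def)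
  have pow_nonneg: "0 \<le> matpow A m $ i $ j" for m i j
  proof (induction m arbitrary: i)
    case 0
    show ?case by (simp add: Finite_Cartesian_Product.mat_def)
  next
    case (Suc m)
    show ?case unfolding step_eq by (intro sum_nonneg mult_nonneg_nonneg nonneg Suc)
  qed
  have step: "0 < matpow A (Suc m) $ i $ j" if "0 < A $ i $ k" "0 < matpow A m $ k $ j" for m i j k
  proof -
    have "0 < A $ i $ k * matpow A m $ k $ j" using that by simp
    also have "\<dots> \<le> matpow A (Suc m) $ i $ j" unfolding step_eq
      by (rule member_le_sum) (auto intro: mult_nonneg_nonneg nonneg pow_nonneg)
    finally show ?thesis .
  qed
  fix j :: 'n
  have "\<exists>m0. \<forall>m\<ge>m0. 0 < matpow A m $ i $ j" for i
  proof -
    have "(i, j) \<in> E\<^sup>*" using E by (simp add: strongly_connected_digraph_def)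
    then show ?thesis
    proof (induction rule: converse_rtrancl_induct)
      case base
      have "0 < matpow A m $ j $ j" for m
      proof (induction m)
        case 0
        show ?case by (simp add: Finite_Cartesian_Product.mat_def)
      next
        case (Suc m)
        show ?case by (rule step[of j j]) (use pos Suc in auto)
      qed
      then show ?case by blast
    next
      case (step i k)
      then obtain m0 where m0: "\<forall>m\<ge>m0. 0 < matpow A m $ k $ j" by blast
      have "0 < A $ i $ k" using pos step.hyps(1) by (simp add: in_nbrs_def)
      then have "0 < matpow A (Suc m) $ i $ j" if "m \<ge> m0" for m
        using \<open>\<And>m k j i. 0 < A $ i $ k \<Longrightarrow> 0 < matpow A m $ k $ j \<Longrightarrow> 0 < matpow A (Suc m) $ i $ j\<close>
          m0 that by blast
      then have "\<forall>m\<ge>Suc m0. 0 < matpow A m $ i $ j"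
        by (metis Suc_le_D Suc_le_mono)
      then show ?case by blast
    qed
  qed
  then obtain g where g: "\<And>i m. m \<ge> g i \<Longrightarrow> 0 < matpow A m $ i $ j" by metis
  have "0 < matpow A (Max (range g)) $ i $ j" for i by (rule g) simp
  then show ?thesis unfolding SIA_def by blast
qed

text \<open>\<open>Rs c\<close> and \<open>b c\<close> describe the PrFTPS executions for the coordinate \<open>c\<close> of the gradients;
  \<open>x t\<close> stacks the iterates \<open>x t $ i\<close> of the nodes.\<close>

definition prftps_gd ::
    "('n::finite) rel \<Rightarrow> ('n \<Rightarrow> real^'p \<Rightarrow> real^'p) \<Rightarrow> real^'n^'n \<Rightarrow> real \<Rightarrow> (nat \<Rightarrow> real^('p::finite)^'n)
      \<Rightarrow> ('p \<Rightarrow> nat \<Rightarrow> 'n run) \<Rightarrow> ('p \<Rightarrow> 'n \<Rightarrow> real Matrix.vec) \<Rightarrow> bool" where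
  "prftps_gd E g A \<eta> x Rs b \<longleftrightarrow>
     (\<forall>c. prftps_execution E (\<lambda>t i. g i (x t $ i) $ c) (Rs c) (b c)) \<and>
     (\<forall>t i. x (Suc t) $ i =
        (\<Sum>j\<in>in_nbrs E i \<union> {i}. A $ i $ j *\<^sub>R x t $ j)
        - \<eta> *\<^sub>R (\<chi> c. the (prftps E (Rs c) (b c) t i)))"

end

theory Submission
  imports Defs
begin

text \<open>
  Why PrFTPS is exact. After the first step the substates evolve by the column-stochastic irreducible
  matrix \<open>P_hat E\<close>. It has a positive fixed vector, so the polynomial \<open>Q_poly E j\<close>, which annihilates
  row \<open>j\<close>, is divisible by \<open>X - 1\<close>. Row \<open>j\<close> of the quotient \<open>p_poly E j\<close>, evaluated at \<open>P_hat E\<close>, is then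
  a nonzero left fixed vector, and by Perron--Frobenius a multiple of the all-ones vector
  (\<open>p_poly_row_constant\<close>). So weighting the observations of node \<open>j\<close> with the coefficients of
  \<open>p_poly E j\<close> yields a multiple of the total of all substates. That total is conserved: it is
  \<open>2 \<Sum>\<^sub>i s\<^sub>i\<close> in the first component and \<open>2 n\<close> in the second. The unknown multiple and the unknown
  scaling of the stored kernel vector cancel in the quotient (\<open>ratio_eq_average\<close>).

  Why the nodes do not stop too early. The same constant row shows that every node reaches \<open>i\<close> in at
  most \<open>D\<^sub>i = degree (p_poly E i)\<close> steps, so a pause of \<open>c\<^sub>i = 2 D\<^sub>i + 3\<close> steps in the max-consensus at \<open>i\<close>
  cannot begin before all counters have been frozen and seen. This gives stopping times above
  \<open>c\<^sub>i + c\<^sub>j\<close> for every \<open>j\<close> (\<open>stop_time_lower_bound\<close>), which covers the samples needed at step \<open>0\<close> and,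
  through \<open>D_max\<close>, at the later steps.

  Why PrFTPS-GD converges linearly. All nodes subtract the same average gradient, so the differences
  of their iterates are governed by \<open>A\<close> alone. A power of \<open>A\<close> with a positive column shrinks the largest
  difference by a fixed factor (\<open>spread_geometric\<close>). One fixed node therefore performs gradient descent
  on the average of the \<open>f i\<close> with a geometrically small error. Since \<open>\<eta> < 1 / (\<mu> + L) < 1 / L\<close>, a
  descent step contracts the distance to \<open>x_star\<close> by \<open>sqrt (1 - \<eta> * \<mu>)\<close> (\<open>gradient_step_contracts\<close>),
  and a contraction with a geometric perturbation converges geometrically.
\<close>

section \<open>Polynomials in a square matrix and the minimal polynomial of a row\<close>

lemma axis_vector_matrix_mult:
  fixes M :: "real^'b::finite^'a::finite"
  shows "axis k 1 v* M = M $ k"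
  by (simp add: vec_eq_iff vector_matrix_mult_def axis_def if_distrib[of "\<lambda>x. x * _"] cong: if_cong)

lemma matpow_commute: "A ** matpow A m = matpow A m ** A"
proof (induction m)
  case (Suc m)
  have "matpow A (Suc m) ** A = A ** (matpow A m ** A)" by (simp add: matrix_mul_assoc)
  with Suc show ?case by simp
qed simp

text \<open>A bound \<open>N\<close> independent of \<open>q\<close> lets polynomials of different degrees be combined termwise.\<close>

lemma poly_mat_eq_sum:
  assumes "degree q \<le> N"
  shows "poly_mat q A = (\<Sum>i\<le>N. coeff q i *\<^sub>R matpow A i)"
  unfolding poly_mat_def
  by (rule sum.mono_neutral_left) (use assms in \<open>auto simp: coeff_eq_0\<close>)

lemma poly_mat_diff: "poly_mat (p - q) A = poly_mat p A - poly_mat q A"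
proof -
  define N where "N = max (degree p) (degree q)"
  have "degree p \<le> N" "degree q \<le> N" "degree (p - q) \<le> N"
    by (auto simp: N_def intro: degree_diff_le)
  then show ?thesis
    by (simp add: poly_mat_eq_sum[of _ N] scaleR_diff_left sum_subtractf)
qed

lemma poly_mat_smult: "poly_mat (smult c p) A = c *\<^sub>R poly_mat p A"
  using degree_smult_le[of c p]
  by (simp add: poly_mat_eq_sum[of _ "degree p"] scaleR_sum_right)

lemma poly_mat_pCons_0: "poly_mat (pCons 0 q) A = poly_mat q A ** A"
proof -
  have "poly_mat (pCons 0 q) A = (\<Sum>i\<le>Suc (degree q). coeff (pCons 0 q) i *\<^sub>R matpow A i)"
    by (rule poly_mat_eq_sum) (rule degree_pCons_le)
  also have "\<dots> = (\<Sum>i\<le>degree q. (coeff q i *\<^sub>R matpow A i) ** A)"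
    unfolding sum.atMost_Suc_shift by (simp add: matpow_commute scalar_matrix_assoc)
  also have "\<dots> = poly_mat q A ** A"
    by (simp add: poly_mat_def vec_eq_iff matrix_matrix_mult_def sum_distrib_right sum.swap[of _ UNIV])
  finally show ?thesis .
qed

lemma poly_mat_times_linear:
  "poly_mat (q * [:-1, 1:]) A = poly_mat q A ** A - poly_mat q A"
proof -
  have "q * [:-1, 1:] = pCons 0 q - q" by (simp add: mult.commute)
  then show ?thesis by (simp add: poly_mat_diff poly_mat_pCons_0)
qed

lemma poly_mat_mult_vector:
  "poly_mat q A *v v = (\<Sum>i\<le>degree q. coeff q i *\<^sub>R (matpow A i *v v))"
  by (simp add: poly_mat_def vec_eq_iff matrix_vector_mult_def sum_distrib_right sum_distrib_left
      sum.swap[of _ UNIV] mult.assoc)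

lemma poly_mat_fixed_vector:
  assumes "A *v v = v"
  shows "poly_mat q A *v v = poly q 1 *\<^sub>R v"
proof -
  have "matpow A i *v v = v" for i
    by (induction i) (simp_all add: assms flip: matrix_vector_mul_assoc)
  then show ?thesis
    by (simp add: poly_mat_mult_vector poly_altdef scaleR_sum_left)
qed

text \<open>The rows \<open>k\<close> of the powers of \<open>A\<close> lie in a finite-dimensional space, so they are linearly
  dependent; the coefficients of a dependency are those of an annihilating polynomial.\<close>

lemma exists_monic_row_annihilator:
  fixes A :: "real^'m::finite^'m"
  shows "\<exists>q. lead_coeff q = 1 \<and> poly_mat q A $ k = 0"
proof -
  define v where "v i = matpow A i $ k" for i
  have "\<exists>q. q \<noteq> 0 \<and> poly_mat q A $ k = 0"
  proof (cases "inj v")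
    case False
    (* Two powers have the same row, which the set of rows does not show. *)
    then obtain i j where ij: "i \<noteq> j" "v i = v j" by (auto simp: inj_def)
    let ?q = "monom 1 i - monom 1 j :: real poly"
    have mono: "poly_mat (monom 1 i) A = matpow A i" for i
      by (simp add: poly_mat_def degree_monom_eq if_distrib[of "\<lambda>x. x *\<^sub>R _"] cong: if_cong)
    have "?q \<noteq> 0" using ij(1) by (metis coeff_monom eq_iff_diff_eq_0 zero_neq_one)
    moreover have "poly_mat ?q A $ k = 0" using ij(2) by (simp add: poly_mat_diff mono v_def)
    ultimately show ?thesis by blast
  next
    case True
    define N where "N = DIM(real^'m)"
    have "dependent (v ` {..N})"
    proof (rule dependent_biggerset)
      show "card (v ` {..N}) > DIM(real^'m)"
        using True by (simp add: card_image N_def inj_on_subset)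
    qed
    then obtain u where u: "\<exists>x\<in>v ` {..N}. u x \<noteq> 0" "(\<Sum>x\<in>v ` {..N}. u x *\<^sub>R x) = 0"
      by (auto simp: dependent_finite)
    define q where "q = (\<Sum>i\<le>N. monom (u (v i)) i)"
    have cq: "coeff q i = (if i \<le> N then u (v i) else 0)" for i
      by (simp add: q_def coeff_sum)
    have "degree q \<le> N" by (rule degree_le) (simp add: cq)
    then have "poly_mat q A $ k = (\<Sum>i\<le>N. u (v i) *\<^sub>R v i)"
      by (simp add: poly_mat_eq_sum cq v_def)
    also have "\<dots> = 0"
      using u(2) True by (simp add: sum.reindex inj_on_subset)
    finally have "poly_mat q A $ k = 0" .
    moreover have "q \<noteq> 0" using u(1) cq by (metis atMost_iff coeff_0 imageE)
    ultimately show ?thesis by blast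
  qed
  then obtain q where "q \<noteq> 0" "poly_mat q A $ k = 0" by blast
  then show ?thesis
    by (intro exI[of _ "smult (inverse (lead_coeff q)) q"]) (simp add: poly_mat_smult)
qed

text \<open>The difference of two monic minimisers has smaller degree, so after normalisation it would
  contradict minimality unless it vanishes.\<close>

lemma ex1_minimal_row_annihilator:
  fixes A :: "real^'m::finite^'m"
  shows "\<exists>!q. lead_coeff q = 1 \<and> poly_mat q A $ k = 0 \<and>
     (\<forall>q'. lead_coeff q' = 1 \<and> poly_mat q' A $ k = 0 \<longrightarrow> degree q \<le> degree q')"
proof -
  let ?ann = "\<lambda>q. lead_coeff q = 1 \<and> poly_mat q A $ k = 0"
  obtain q where q: "?ann q" and min: "\<And>q'. ?ann q' \<Longrightarrow> degree q \<le> degree q'"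
    using exists_monic_row_annihilator[of A k] ex_has_least_nat[of ?ann _ degree] by blast
  show ?thesis
  proof (rule ex1I[of _ q])
    show "lead_coeff q = 1 \<and> poly_mat q A $ k = 0 \<and> (\<forall>q'. ?ann q' \<longrightarrow> degree q \<le> degree q')"
      using q min by simp
  next
    fix q'
    assume *: "lead_coeff q' = 1 \<and> poly_mat q' A $ k = 0 \<and> (\<forall>q''. ?ann q'' \<longrightarrow> degree q' \<le> degree q'')"
    then have q': "?ann q'" by simp
    show "q' = q"
    proof (rule ccontr)
      assume "q' \<noteq> q"
      define d where "d = q' - q"
      have deg: "degree q' = degree q" using * q min[OF q'] by (simp add: le_antisym)
      have d0: "d \<noteq> 0" using \<open>q' \<noteq> q\<close> by (simp add: d_def)
      have "degree d < degree q"
      proof -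
        have "degree d \<le> degree q" unfolding d_def using deg by (simp add: degree_diff_le)
        moreover have "coeff d (degree q) = 0"
          using q q' deg by (simp only: d_def coeff_diff)
        ultimately show ?thesis using d0 by (metis leading_coeff_0_iff le_neq_implies_less)
      qed
      moreover have "degree q \<le> degree (smult (inverse (lead_coeff d)) d)"
      proof (rule min)
        have "poly_mat d A $ k = 0" using q q' by (simp add: d_def poly_mat_diff)
        with d0 show "?ann (smult (inverse (lead_coeff d)) d)" by (simp add: poly_mat_smult)
      qed
      ultimately show False using d0 by simp
    qed
  qed
qed

lemma Q_poly_properties:
  shows "lead_coeff (Q_poly E j) = 1"
    and "poly_mat (Q_poly E j) (P_hat E) $ Inl j = 0"
    and "\<And>q. lead_coeff q = 1 \<Longrightarrow> poly_mat q (P_hat E) $ Inl j = 0 \<Longrightarrow> degree (Q_poly E j) \<le> degree q"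
  using theI'[OF ex1_minimal_row_annihilator[of "P_hat E" "Inl j"]]
  unfolding Q_poly_def annihilates_def axis_vector_matrix_mult by blast+

section \<open>Perron--Frobenius theory of irreducible column-stochastic matrices\<close>

definition column_stochastic :: "real^'m^'m \<Rightarrow> bool" where
  "column_stochastic A \<longleftrightarrow> (\<forall>r c. 0 \<le> A $ r $ c) \<and> (\<forall>c. (\<Sum>r\<in>UNIV. A $ r $ c) = 1)"

definition irreducible_mat :: "real^'m^'m \<Rightarrow> bool" where
  "irreducible_mat A \<longleftrightarrow> (\<forall>r c. (r, c) \<in> {(r, c). 0 < A $ r $ c}\<^sup>*)"

lemma weighted_average_eq_max:
  fixes a w :: "'m::finite \<Rightarrow> real"
  assumes "\<And>r. 0 \<le> a r" and "(\<Sum>r\<in>UNIV. a r) = 1" and "\<And>r. w r \<le> M"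
    and "(\<Sum>r\<in>UNIV. a r * w r) = M" and "0 < a s"
  shows "w s = M"
proof -
  have "(\<Sum>r\<in>UNIV. a r * (M - w r)) = 0"
    using assms(2,4) by (simp add: right_diff_distrib sum_subtractf flip: sum_distrib_right)
  then have "a s * (M - w s) = 0"
    using assms(1,3) by (subst (asm) sum_nonneg_eq_0_iff) auto
  with assms(5) show ?thesis by simp
qed

text \<open>Each entry of a left fixed vector is an average of all entries with the weights of a column,
  so a maximal entry forces its neighbours to be maximal too.\<close>

lemma left_fixed_vector_constant:
  fixes A :: "real^'m::finite^'m"
  assumes "column_stochastic A" "irreducible_mat A" and w: "w v* A = w"
  shows "w $ r = w $ s"
proof -
  define M where "M = Max (range (($) w))"
  have le: "w $ r \<le> M" for r by (simp add: M_def)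
  have "M \<in> range (($) w)" unfolding M_def by (rule Max_in) auto
  then obtain c where c: "w $ c = M" by auto
  have "w $ r = M" for r
  proof -
    have "(r, c) \<in> {(r, c). 0 < A $ r $ c}\<^sup>*" using assms by (simp add: irreducible_mat_def)
    then show ?thesis
    proof (induction rule: converse_rtrancl_induct)
      case base
      show ?case by (fact c)
    next
      case (step x y)
      have "(\<Sum>r\<in>UNIV. A $ r $ y * w $ r) = M"
        using arg_cong[OF w, of "\<lambda>v. v $ y"] step.IH by (simp add: vector_matrix_mult_def mult.commute)
      with step.hyps(1) show ?case
        using weighted_average_eq_max[of "\<lambda>r. A $ r $ y" "($) w" M x] assms(1) le
        by (simp add: column_stochastic_def)
    qed
  qed
  then show ?thesis by simp
qed

text \<open>Column sums \<open>1\<close> make \<open>A - 1\<close> singular. For a fixed vector \<open>u\<close> the triangle inequality gives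
  \<open>\<bar>u\<bar> \<le> A \<bar>u\<bar>\<close>, and both sides have the same sum; so \<open>\<bar>u\<bar>\<close> is fixed as well, and irreducibility
  excludes zero entries.\<close>

lemma exists_positive_fixed_vector:
  fixes A :: "real^'m::finite^'m"
  assumes A: "column_stochastic A" "irreducible_mat A"
  shows "\<exists>v. A *v v = v \<and> (\<forall>i. 0 < v $ i)"
proof -
  have sum_A: "(\<Sum>r\<in>UNIV. (A *v u) $ r) = (\<Sum>r\<in>UNIV. u $ r)" for u
    using A(1) by (simp add: matrix_vector_mult_def column_stochastic_def sum.swap[of _ UNIV UNIV]
        flip: sum_distrib_right)
  (* Otherwise A - 1 is surjective, but its values have entry sum 0, unlike a unit vector. *)
  have "\<not> inj (\<lambda>u. A *v u - u)"
  proof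
    assume "inj (\<lambda>u. A *v u - u)"
    moreover have "linear (\<lambda>u. A *v u - u)"
      by (intro linear_compose_sub matrix_vector_mul_linear linear_ident)
    ultimately have "surj (\<lambda>u. A *v u - u)" by (intro linear_injective_imp_surjective) auto
    then obtain u where u: "axis undefined 1 = A *v u - u" unfolding surj_def by blast
    have "(\<Sum>r\<in>UNIV. axis undefined (1::real) $ (r::'m)) = 0"
      unfolding u by (simp add: sum_subtractf sum_A)
    then show False by (simp add: axis_def)
  qed
  then obtain u0 u1 where "u0 \<noteq> u1" "A *v u0 - u0 = A *v u1 - u1" by (auto simp: inj_def)
  then have u: "A *v (u0 - u1) = u0 - u1" "u0 - u1 \<noteq> 0"
    by (simp_all add: matrix_vector_mult_diff_distrib algebra_simps)
  (* The difference of two points with the same image under A - 1 is the fixed vector u. *)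
  define v where "v = (\<chi> i. \<bar>(u0 - u1) $ i\<bar>)"
  have ge: "v $ r \<le> (A *v v) $ r" for r
  proof -
    have "v $ r = \<bar>\<Sum>c\<in>UNIV. A $ r $ c * (u0 - u1) $ c\<bar>"
      using arg_cong[OF u(1), of "\<lambda>v. v $ r"] by (simp add: v_def matrix_vector_mult_def)
    also have "\<dots> \<le> (\<Sum>c\<in>UNIV. \<bar>A $ r $ c * (u0 - u1) $ c\<bar>)" by (rule sum_abs)
    also have "\<dots> = (A *v v) $ r"
      using A(1) by (simp add: v_def matrix_vector_mult_def abs_mult column_stochastic_def)
    finally show ?thesis .
  qed
  have "(\<Sum>r\<in>UNIV. (A *v v) $ r - v $ r) = 0" by (simp add: sum_subtractf sum_A)
  then have fixed: "A *v v = v"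
    using ge by (subst (asm) sum_nonneg_eq_0_iff) (auto simp: vec_eq_iff)
  have nonneg: "0 \<le> v $ i" for i by (simp add: v_def)
  have "v $ i \<noteq> 0" for i
  proof
    assume i: "v $ i = 0"
    have "v $ c = 0" for c
    proof -
      have "(i, c) \<in> {(r, c). 0 < A $ r $ c}\<^sup>*" using A by (simp add: irreducible_mat_def)
      then show ?thesis
      proof (induction rule: rtrancl_induct)
        case base
        show ?case by (fact i)
      next
        case (step x y)
        have "(\<Sum>c\<in>UNIV. A $ x $ c * v $ c) = 0"
          using arg_cong[OF fixed, of "\<lambda>v. v $ x"] step.IH by (simp add: matrix_vector_mult_def)
        then have "A $ x $ y * v $ y = 0"
          using A(1) nonneg by (subst (asm) sum_nonneg_eq_0_iff) (auto simp: column_stochastic_def)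
        with step.hyps(2) show ?case by simp
      qed
    qed
    then have "u0 - u1 = 0" by (simp add: v_def vec_eq_iff)
    with u(2) show False by simp
  qed
  with fixed nonneg show ?thesis by (metis order_le_less)
qed

section \<open>The quotient polynomial sums the node states\<close>

lemma sum_UNIV_sum_type:
  "(\<Sum>r\<in>(UNIV :: ('a::finite + 'b::finite) set). h r) = (\<Sum>i\<in>UNIV. h (Inl i)) + (\<Sum>i\<in>UNIV. h (Inr i))"
  by (simp add: sum.Plus flip: UNIV_Plus_UNIV)

text \<open>Node \<open>j\<close> splits its alpha-substate evenly between its out-neighbours, itself and its own
  beta-substate. Since \<open>j\<close> is not its own out-neighbour, these are \<open>2 + out_deg E j\<close> shares.\<close>

lemma P_hat_column_stochastic:
  assumes "strongly_connected_digraph E"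
  shows "column_stochastic (P_hat E)"
proof -
  have "(\<Sum>r\<in>UNIV. P_hat E $ r $ c) = 1" for c
  proof (cases c)
    case (Inl j)
    have "j \<notin> out_nbrs E j"
      using assms by (auto simp: strongly_connected_digraph_def out_nbrs_def irrefl_def)
    then have "card (out_nbrs E j \<union> {j}) = out_deg E j + 1"
      by (simp add: out_deg_def)
    then have "(\<Sum>i\<in>UNIV. p_const E i j) = (real (out_deg E j) + 1) / (2 + real (out_deg E j))"
      unfolding p_const_def by (simp only: sum.If_cases finite Collect_mem_eq Int_UNIV_left) simp
    then show ?thesis
      using Inl by (simp add: sum_UNIV_sum_type P_hat_def a_const_def divide_simps)
  next
    case (Inr j)
    then show ?thesis by (simp add: sum_UNIV_sum_type P_hat_def)
  qed
  moreover have "0 \<le> P_hat E $ r $ c" for r c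
    by (simp add: P_hat_def p_const_def a_const_def split: sum.split)
  ultimately show ?thesis by (simp add: column_stochastic_def)
qed

text \<open>Each beta-substate communicates both ways with the alpha-substate of its node, and the
  alpha-substates communicate along \<open>E\<close>.\<close>

lemma P_hat_irreducible:
  assumes "strongly_connected_digraph E"
  shows "irreducible_mat (P_hat E)"
proof -
  let ?S = "{(r, c). 0 < P_hat E $ r $ c}"
  have edge: "(Inl i, Inl j) \<in> ?S" if "(i, j) \<in> E" for i j
    using that by (simp add: P_hat_def p_const_def out_nbrs_def)
  have Inl: "(Inl i, Inl j) \<in> ?S\<^sup>*" for i j
  proof -
    have "(i, j) \<in> E\<^sup>*" using assms by (simp add: strongly_connected_digraph_def)
    then show ?thesis
    proof (induction rule: rtrancl_induct)
      case (step k j)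
      show ?case by (rule rtrancl_into_rtrancl[OF step.IH edge[OF step.hyps(2)]])
    qed simp
  qed
  have "(Inl i, Inr i) \<in> ?S" "(Inr i, Inl i) \<in> ?S" for i
    by (simp_all add: P_hat_def a_const_def)
  then have down: "(Inl i, Inr i) \<in> ?S\<^sup>*" and up: "(Inr i, Inl i) \<in> ?S\<^sup>*" for i by blast+
  show ?thesis unfolding irreducible_mat_def
  proof (intro allI)
    fix r c :: "'a + 'a"
    obtain i where "(r, Inl i) \<in> ?S\<^sup>*" using up by (cases r) blast+
    moreover obtain j where "(Inl j, c) \<in> ?S\<^sup>*" using down by (cases c) blast+
    ultimately show "(r, c) \<in> ?S\<^sup>*" using Inl[of i j] by (meson rtrancl_trans)
  qed
qed

text \<open>\<open>1\<close> is a root of \<open>Q_poly E j\<close>: a positive fixed vector \<open>v\<close> turns annihilation of row \<open>j\<close> into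
  \<open>poly (Q_poly E j) 1 * v\<^sub>j = 0\<close>. So the division that defines \<open>p_poly\<close> is exact.\<close>

lemma Q_poly_eq_p_poly_times:
  assumes "strongly_connected_digraph E"
  shows "Q_poly E j = p_poly E j * [:-1, 1:]"
proof -
  obtain v where v: "P_hat E *v v = v" "\<And>i. 0 < v $ i"
    using exists_positive_fixed_vector P_hat_column_stochastic P_hat_irreducible assms by blast
  have "poly (Q_poly E j) 1 * v $ Inl j = (poly_mat (Q_poly E j) (P_hat E) *v v) $ Inl j"
    by (simp add: poly_mat_fixed_vector[OF v(1)])
  also have "\<dots> = 0"
    using Q_poly_properties(2)[of E j] by (simp add: matrix_vector_mult_def)
  finally have "poly (Q_poly E j) 1 = 0" using v(2)[of "Inl j"] by simp
  then show ?thesis by (simp only: p_poly_def poly_eq_0_iff_dvd dvd_div_mult_self)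
qed

text \<open>Row \<open>j\<close> of \<open>p_poly E j\<close> evaluated at \<open>P_hat E\<close> is killed by \<open>P_hat E - 1\<close> on the right, because the
  product is row \<open>j\<close> of \<open>Q_poly\<close>. So it is a left fixed vector, hence a multiple of the all-ones
  vector; it is nonzero because \<open>Q_poly\<close> has minimal degree. This is how the
  observations of a single node come to determine the sum of all states.\<close>

lemma p_poly_row_constant:
  assumes E: "strongly_connected_digraph E"
  obtains \<kappa> where "\<kappa> \<noteq> 0" and "\<And>r. poly_mat (p_poly E j) (P_hat E) $ Inl j $ r = \<kappa>"
proof -
  let ?p = "p_poly E j" and ?Q = "Q_poly E j"
  define w where "w = poly_mat ?p (P_hat E) $ Inl j"
  have Q: "?Q = ?p * [:-1, 1:]" by (rule Q_poly_eq_p_poly_times[OF E])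
  have lc: "lead_coeff ?p = 1"
    using Q_poly_properties(1)[of E j] unfolding Q by (simp only: lead_coeff_mult) simp
  then have "?p \<noteq> 0" by auto
  then have "degree ?p < degree ?Q" unfolding Q by (subst degree_mult_eq) auto
  then have "w \<noteq> 0" using Q_poly_properties(3)[of ?p E j] lc by (force simp: w_def)
  have "(poly_mat ?p (P_hat E) ** P_hat E) $ Inl j = w"
    using Q_poly_properties(2)[of E j] unfolding Q poly_mat_times_linear by (simp add: w_def)
  then have "w v* P_hat E = w"
    by (simp add: w_def vec_eq_iff matrix_matrix_mult_def vector_matrix_mult_def mult.commute)
  then have const: "w $ r = w $ s" for r s
    using left_fixed_vector_constant P_hat_column_stochastic P_hat_irreducible E by blast
  show thesis
  proof
    show "w $ Inl j \<noteq> 0" using \<open>w \<noteq> 0\<close> const by (metis vec_eq_iff zero_index)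
    show "poly_mat ?p (P_hat E) $ Inl j $ r = w $ Inl j" for r
      using const by (simp flip: w_def)
  qed
qed

section \<open>The output of PrFTPS\<close>

definition state_vec :: "('n::finite) rel \<Rightarrow> 'n run \<Rightarrow> nat \<Rightarrow> nat \<Rightarrow> real^('n + 'n)" where
  "state_vec E R l k = (\<chi> r. case r of Inl i \<Rightarrow> x_alpha E R l k i | Inr i \<Rightarrow> x_beta E R l k i)"

lemma sum_in_nbrs_p_const:
  fixes E :: "('n::finite) rel"
  shows "(\<Sum>j\<in>insert i (in_nbrs E i). p_const E i j * h j) = (\<Sum>j\<in>UNIV. p_const E i j * h j)"
  by (rule sum.mono_neutral_left) (auto simp: in_nbrs_def p_const_def out_nbrs_def)

lemma state_vec_Suc:
  fixes E :: "('n::finite) rel"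
  assumes "0 < k"
  shows "state_vec E R l (Suc k) = P_hat E *v state_vec E R l k"
proof -
  have "state_vec E R l (Suc k) $ r = (P_hat E *v state_vec E R l k) $ r" for r
    using assms
    by (cases r) (simp_all add: state_vec_def matrix_vector_mult_def P_hat_def sum_UNIV_sum_type
        weight_p_def weight_ab_def weight_ba_def weight_bb_def sum_in_nbrs_p_const
        if_distrib[of "\<lambda>x. x * _"] cong: if_cong)
  then show ?thesis by (simp add: vec_eq_iff)
qed

lemma state_vec_matpow: "state_vec E R l (Suc m) = matpow (P_hat E) m *v state_vec E R l 1"
  by (induction m) (simp_all add: state_vec_Suc matrix_vector_mul_assoc)

text \<open>The columns of weights sum to \<open>1\<close> also at time \<open>0\<close>, so the total of all substates survives the
  first step.\<close>

lemma sum_state_vec_1: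
  fixes E :: "('n::finite) rel"
  assumes "valid_run E s R"
  shows "(\<Sum>r\<in>UNIV. state_vec E R l 1 $ r) = (\<Sum>i\<in>UNIV. init_alpha R l i + init_beta R l i)"
proof -
  have supp: "init_p R i j = 0" if "j \<notin> in_nbrs E i \<union> {i}" for i j
    using assms that by (auto simp: valid_run_def in_nbrs_def out_nbrs_def)
  have "(\<Sum>j\<in>in_nbrs E i \<union> {i}. init_p R i j * init_alpha R l j) =
      (\<Sum>j\<in>UNIV. init_p R i j * init_alpha R l j)" for i
    by (rule sum.mono_neutral_left) (use supp in auto)
  then have "(\<Sum>r\<in>UNIV. state_vec E R l 1 $ r) =
      (\<Sum>i\<in>UNIV. \<Sum>j\<in>UNIV. init_p R i j * init_alpha R l j)
      + (\<Sum>i\<in>UNIV. init_beta R l i) + (\<Sum>i\<in>UNIV. init_a R i * init_alpha R l i)"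
    by (simp add: state_vec_def sum_UNIV_sum_type weight_p_def weight_ab_def weight_ba_def
        weight_bb_def sum.distrib)
  also have "(\<Sum>i\<in>UNIV. \<Sum>j\<in>UNIV. init_p R i j * init_alpha R l j) =
      (\<Sum>j\<in>UNIV. (\<Sum>i\<in>UNIV. init_p R i j) * init_alpha R l j)"
    by (subst sum.swap) (simp add: sum_distrib_right)
  also have "\<dots> = (\<Sum>j\<in>UNIV. (1 - init_a R j) * init_alpha R l j)"
  proof -
    have "(\<Sum>i\<in>UNIV. init_p R i j) = 1 - init_a R j" for j
      using assms by (simp add: valid_run_def algebra_simps eq_diff_eq)
    then show ?thesis by simp
  qed
  finally show ?thesis by (simp add: left_diff_distrib sum_subtractf sum.distrib)
qed

lemma observations_weighted_by_p_poly:
  fixes E :: "('n::finite) rel"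
  assumes "valid_run E s R"
    and row: "\<And>r. poly_mat (p_poly E j) (P_hat E) $ Inl j $ r = \<kappa>"
  shows "(\<Sum>m\<le>degree (p_poly E j). coeff (p_poly E j) m * x_alpha E R l (m + 1) j)
    = \<kappa> * (\<Sum>i\<in>UNIV. init_alpha R l i + init_beta R l i)"
proof -
  have "(\<Sum>m\<le>degree (p_poly E j). coeff (p_poly E j) m * x_alpha E R l (m + 1) j)
    = (poly_mat (p_poly E j) (P_hat E) *v state_vec E R l 1) $ Inl j"
    unfolding poly_mat_mult_vector state_vec_matpow[symmetric] by (simp add: state_vec_def)
  also have "\<dots> = \<kappa> * (\<Sum>r\<in>UNIV. state_vec E R l 1 $ r)"
    by (simp add: matrix_vector_mult_def row sum_distrib_left)
  finally show ?thesis by (simp only: sum_state_vec_1[OF assms(1)])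
qed

text \<open>Numerator and denominator carry the same factor \<open>c * \<kappa>\<close>, from the scaling of the kernel vector
  and from the constant row. What remains is \<open>2 \<Sum>\<^sub>i s\<^sub>i\<close> over \<open>2 n\<close>.\<close>

lemma ratio_eq_average:
  fixes E :: "('n::finite) rel"
  assumes E: "strongly_connected_digraph E" and R: "valid_run E s R"
    and b: "c \<noteq> 0" "b = c \<cdot>\<^sub>v beta_vec E j"
  shows "ratio E R b j = (\<Sum>i\<in>UNIV. s i) / real CARD('n)"
proof -
  obtain \<kappa> where \<kappa>: "\<kappa> \<noteq> 0" "\<And>r. poly_mat (p_poly E j) (P_hat E) $ Inl j $ r = \<kappa>"
    using p_poly_row_constant[OF E] by blast
  have prod: "scalar_prod (Matrix.vec (dim_vec b) (\<lambda>m. x_alpha E R l (m + 1) j)) b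
      = c * \<kappa> * (\<Sum>i\<in>UNIV. init_alpha R l i + init_beta R l i)" for l
  proof -
    have "scalar_prod (Matrix.vec (dim_vec b) (\<lambda>m. x_alpha E R l (m + 1) j)) b
      = (\<Sum>m\<in>{0..<Suc (degree (p_poly E j))}. x_alpha E R l (m + 1) j * (c * coeff (p_poly E j) m))"
      by (simp add: scalar_prod_def b beta_vec_def)
    also have "\<dots> = c * (\<Sum>m\<le>degree (p_poly E j). coeff (p_poly E j) m * x_alpha E R l (m + 1) j)"
      unfolding atLeast0LessThan lessThan_Suc_atMost sum_distrib_left
      by (intro sum.cong) (simp_all add: algebra_simps)
    finally show ?thesis
      unfolding observations_weighted_by_p_poly[OF R \<kappa>(2)] by (simp only: mult.assoc)
  qed
  have "(\<Sum>i\<in>UNIV. init_alpha R 1 i + init_beta R 1 i) = 2 * (\<Sum>i\<in>UNIV. s i)"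
    "(\<Sum>i\<in>UNIV. init_alpha R 2 i + init_beta R 2 i) = 2 * real CARD('n)"
    using R by (simp_all add: valid_run_def sum_distrib_left)
  with b(1) \<kappa>(1) show ?thesis unfolding ratio_def prod by simp
qed

section \<open>Termination of the distributed stopping rule\<close>

text \<open>The reflexive closure of \<open>E\<close> admits waiting at a node. A step between the two substates of one
  node counts as waiting.\<close>

lemma matpow_P_hat_support:
  assumes "matpow (P_hat E) m $ Inl i $ r \<noteq> 0" and "r = Inl j \<or> r = Inr j"
  shows "(i, j) \<in> (E\<^sup>=) ^^ m"
  using assms
proof (induction m arbitrary: r j)
  case 0
  then show ?case by (auto simp: Finite_Cartesian_Product.mat_def split: if_splits)
next
  case (Suc m)
  have "(\<Sum>k\<in>UNIV. matpow (P_hat E) m $ Inl i $ k * P_hat E $ k $ r) \<noteq> 0"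
    using Suc.prems(1) by (simp add: matpow_commute) (simp add: matrix_matrix_mult_def)
  then obtain k where "matpow (P_hat E) m $ Inl i $ k * P_hat E $ k $ r \<noteq> 0"
    by (rule sum.not_neutral_contains_not_neutral)
  then have k: "matpow (P_hat E) m $ Inl i $ k \<noteq> 0" "P_hat E $ k $ r \<noteq> 0" by auto
  obtain j' where j': "k = Inl j' \<or> k = Inr j'" by (cases k) auto
  have "(j', j) \<in> E\<^sup>="
    using k(2) j' Suc.prems(2) by (auto simp: P_hat_def p_const_def out_nbrs_def split: if_splits)
  with Suc.IH[OF k(1) j'] show ?case by auto
qed

text \<open>The constant nonzero row of \<open>p_poly E i\<close> is a combination of row \<open>i\<close> of the powers up to \<open>D\<^sub>i\<close>. Its
  entry at \<open>j\<close> does not vanish, so one of these powers has a nonzero entry there. This ties the degree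
  known to node \<open>i\<close> to its distance from all other nodes, which the stopping rule needs.\<close>

lemma path_length_le_degree_p_poly:
  assumes E: "strongly_connected_digraph E"
  obtains m where "m \<le> degree (p_poly E i)" and "(i, j) \<in> (E\<^sup>=) ^^ m"
proof -
  obtain \<kappa> where \<kappa>: "\<kappa> \<noteq> 0" "\<And>r. poly_mat (p_poly E i) (P_hat E) $ Inl i $ r = \<kappa>"
    using p_poly_row_constant[OF E] by blast
  have "(\<Sum>m\<le>degree (p_poly E i). coeff (p_poly E i) m * matpow (P_hat E) m $ Inl i $ Inl j) \<noteq> 0"
    using \<kappa>(1) \<kappa>(2)[of "Inl j"] by (simp add: poly_mat_def)
  then obtain m where "m \<le> degree (p_poly E i)" "matpow (P_hat E) m $ Inl i $ Inl j \<noteq> 0"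
    by (auto elim!: sum.not_neutral_contains_not_neutral)
  then show thesis using that matpow_P_hat_support by blast
qed

lemma max_le_theta_Suc:
  fixes E :: "('n::finite) rel"
  assumes "(i, j) \<in> E\<^sup>="
  shows "max (theta E R k j) (c_count E R k j) \<le> theta E R (Suc k) i"
  unfolding theta.simps by (rule Max_ge) (use assms in \<open>auto simp: in_nbrs_def\<close>)

lemma theta_mono:
  fixes E :: "('n::finite) rel"
  assumes "k \<le> k'"
  shows "theta E R k i \<le> theta E R k' i"
  using _ assms
proof (rule lift_Suc_mono_le)
  show "theta E R k i \<le> theta E R (Suc k) i" for k
    using max_le_theta_Suc[of i i E R k] by (simp del: theta.simps)
qed

lemma theta_lower_bound:
  fixes E :: "('n::finite) rel"
  assumes "(i, j) \<in> (E\<^sup>=) ^^ m"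
  shows "c_count E R k j \<le> theta E R (Suc (k + m)) i"
  using assms
proof (induction m arbitrary: i)
  case 0
  then show ?case using max_le_theta_Suc[of i j E R k] by (simp del: theta.simps)
next
  case (Suc m)
  then obtain i' where "(i, i') \<in> E\<^sup>=" "(i', j) \<in> (E\<^sup>=) ^^ m" by (metis relpow_Suc_D2)
  with Suc.IH[of i'] max_le_theta_Suc[of i i' E R "Suc (k + m)"] show ?case
    by (simp del: theta.simps)
qed

lemma theta_upper_bound:
  fixes E :: "('n::finite) rel"
  shows "theta E R k i \<le> k - 1"
proof (induction k arbitrary: i)
  case (Suc k)
  have "theta E R k j \<le> k" for j using Suc.IH[of j] by simp
  then show ?case by (auto simp: c_count_def)
qed simp

lemma theta_bounded:
  fixes E :: "('n::finite) rel"
  shows "theta E R k i \<le> Max (range (c_frozen E R))"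
proof (induction k arbitrary: i)
  case (Suc k)
  have "c_count E R k j \<le> Max (range (c_frozen E R))" for j
    by (rule order_trans[of _ "c_frozen E R j"]) (simp_all add: c_count_def)
  with Suc.IH show ?case by auto
qed simp

lemma theta_constant_during_r_count:
  "r_count E R k i \<le> k \<and> theta E R (k - r_count E R k i) i = theta E R k i"
  by (induction k) (auto simp: Suc_diff_le simp del: theta.simps)

text \<open>The counter rises by at most one per step, starting at \<open>0\<close>.\<close>

lemma r_count_intermediate_value:
  "r \<le> r_count E R k i \<Longrightarrow> \<exists>k'. r_count E R k' i = r"
proof (induction k)
  case (Suc k)
  show ?case
  proof (cases "r \<le> r_count E R k i")
    case False
    then have "r = 0 \<or> r = r_count E R (Suc k) i" using Suc.prems by (auto split: if_splits)
    moreover have "r_count E R 0 i = 0" by simp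
    ultimately show ?thesis by metis
  qed (use Suc.IH in blast)
qed (auto intro: exI[of _ 0])

text \<open>A bounded monotone sequence of naturals becomes stationary, and from then on the counter grows
  forever.\<close>

lemma r_count_attains:
  fixes E :: "('n::finite) rel"
  shows "\<exists>k. r_count E R k i = c"
proof -
  let ?\<theta> = "\<lambda>k. theta E R k i"
  have fin: "finite (range ?\<theta>)"
    by (rule finite_subset[of _ "{..Max (range (c_frozen E R))}"]) (auto intro: theta_bounded)
  have "Max (range ?\<theta>) \<in> range ?\<theta>" by (rule Max_in[OF fin]) auto
  then obtain K where K: "?\<theta> K = Max (range ?\<theta>)" by auto
  have const: "?\<theta> k = ?\<theta> K" if "K \<le> k" for k
    using theta_mono[OF that, of E R i] Max_ge[OF fin, of "?\<theta> k"] K by force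
  have "m \<le> r_count E R (K + m) i" for m
  proof (induction m)
    case (Suc m)
    have "?\<theta> (Suc (K + m)) = ?\<theta> (K + m)" using const[of "Suc (K + m)"] const[of "K + m"] by simp
    with Suc show ?case by (simp del: theta.simps)
  qed simp
  then show ?thesis by (rule r_count_intermediate_value)
qed

text \<open>When node \<open>i\<close> stops at time \<open>k\<close>, its \<open>theta\<close> has had the same value since time \<open>k - c\<^sub>i\<close>. That
  value is at most \<open>k - c\<^sub>i - 1\<close>, because \<open>theta\<close> lags at least one step behind the counters. On the
  other hand, at time \<open>k\<close> it is at least the counter of node \<open>j\<close> at time \<open>k - m - 1\<close>, and
  \<open>k - m - 1 > k - c\<^sub>i - 1\<close>. So that counter was no longer running, but frozen at \<open>c\<^sub>j \<le> k - c\<^sub>i - 1\<close>.\<close>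

lemma stop_time_lower_bound:
  fixes E :: "('n::finite) rel"
  assumes "(i, j) \<in> (E\<^sup>=) ^^ m" and "m + 1 < c_frozen E R i"
  shows "c_frozen E R i + c_frozen E R j < stop_time E R i"
proof -
  define k where "k = stop_time E R i"
  let ?ci = "c_frozen E R i" and ?cj = "c_frozen E R j"
  have stop: "r_count E R k i = ?ci"
    unfolding k_def stop_time_def using r_count_attains by (rule LeastI_ex)
  have ci: "?ci \<le> k" and const: "theta E R (k - ?ci) i = theta E R k i"
    using theta_constant_during_r_count[of E R k i] stop by auto
  have "min (k - Suc m) ?cj \<le> theta E R k i"
    using theta_lower_bound[OF assms(1), of R "k - Suc m"] ci assms(2) by (simp add: c_count_def del: theta.simps)
  also have "\<dots> \<le> k - ?ci - 1" using theta_upper_bound[of E R "k - ?ci" i] const by simp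
  finally have "min (k - Suc m) ?cj \<le> k - ?ci - 1" .
  moreover have "0 < ?cj" by (simp add: c_frozen_def)
  ultimately show ?thesis using ci assms(2) unfolding k_def[symmetric] by (auto simp: min_def split: if_splits)
qed

text \<open>A kernel vector of the defective Hankel matrix has \<open>defect_index + 1\<close> entries and a multiple of
  \<open>beta_vec\<close> has \<open>D\<^sub>j + 1\<close>, so the defect index is \<open>D\<^sub>j\<close> and every frozen counter is \<open>2 D\<^sub>j + 3\<close>. The
  bound on the stopping times then provides all samples that the output formula reads.\<close>

lemma prftps_eq_average:
  fixes E :: "('n::finite) rel"
  assumes E: "strongly_connected_digraph E"
    and ex: "prftps_execution E s Rs b" and ne: "non_exceptional E b"
  shows "prftps E Rs b t j = Some ((\<Sum>i\<in>UNIV. s t i) / real CARD('n))"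
proof -
  let ?D = "\<lambda>i. degree (p_poly E i)"
  have dim_b: "dim_vec (b i) = ?D i + 1" for i
    using ne by (metis non_exceptional_def beta_vec_def dim_vec index_smult_vec(2))
  have defect: "defect_index E (Rs 0) i = ?D i" for i
  proof -
    have "stored_vector E (Rs 0) i (b i)" using ex by (simp add: prftps_execution_def)
    then have "dim_vec (b i) = defect_index E (Rs 0) i + 1"
      by (auto simp: stored_vector_def mat_kernel_def hankel_def)
    with dim_b show ?thesis by simp
  qed
  have c: "c_frozen E (Rs 0) i = 2 * ?D i + 3" for i by (simp add: c_frozen_def defect)
  have stop: "2 * ?D i + 2 * ?D j + 6 < stop_time E (Rs 0) i" for i
  proof -
    obtain m where m: "m \<le> ?D i" "(i, j) \<in> (E\<^sup>=) ^^ m" using path_length_le_degree_p_poly[OF E] .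
    show ?thesis using stop_time_lower_bound[OF m(2), of "Rs 0"] m(1) by (simp add: c)
  qed
  have "\<forall>i. \<exists>k. r_count E (Rs 0) k i = c_frozen E (Rs 0) i" using r_count_attains by blast
  moreover have "2 * dim_vec (b j) \<le> stop_time E (Rs 0) i" for i
    using stop[of i] by (simp add: dim_b)
  moreover have "real (dim_vec (b j)) \<le> D_max E (Rs 0) i + 2" for i
    using stop[of i] by (simp add: dim_b D_max_def defect field_simps)
  moreover have "ratio E (Rs t) (b j) j = (\<Sum>i\<in>UNIV. s t i) / real CARD('n)"
    using ne ex ratio_eq_average[OF E] unfolding non_exceptional_def prftps_execution_def by blast
  ultimately show ?thesis by (simp add: prftps_def)
qed

section \<open>Gradient descent for a strongly convex smooth function\<close>

lemma has_real_derivative_along_line: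
  fixes h :: "'a::euclidean_space \<Rightarrow> real"
  assumes "\<And>z. GDERIV h z :> G z"
  shows "((\<lambda>s. h (x + s *\<^sub>R d)) has_real_derivative inner (G (x + s *\<^sub>R d)) d) (at s)"
proof -
  have "((\<lambda>s. x + s *\<^sub>R d) has_derivative (\<lambda>s. s *\<^sub>R d)) (at s)"
    by (auto intro!: derivative_eq_intros)
  then have "((\<lambda>s. h (x + s *\<^sub>R d)) has_derivative (\<lambda>r. inner (r *\<^sub>R d) (G (x + s *\<^sub>R d)))) (at s)"
    by (rule has_derivative_compose) (use assms in \<open>simp add: gderiv_def\<close>)
  moreover have "(\<lambda>r. inner (r *\<^sub>R d) (G (x + s *\<^sub>R d))) = (*) (inner (G (x + s *\<^sub>R d)) d)"
    by (simp add: fun_eq_iff inner_commute)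
  ultimately show ?thesis by (simp add: has_field_derivative_def)
qed

text \<open>Along the ray from \<open>x\<close> in direction \<open>d\<close>, the difference between \<open>h\<close> and the quadratic on the
  right has a nonpositive derivative. The one-sided form of the hypothesis serves two purposes: for
  \<open>h\<close> it follows from a Lipschitz gradient, and for \<open>- h\<close> with \<open>- \<mu>\<close> in place of \<open>L\<close> it is strong
  monotonicity, which gives the quadratic lower bound.\<close>

lemma quadratic_upper_bound:
  fixes h :: "'a::euclidean_space \<Rightarrow> real"
  assumes h: "\<And>z. GDERIV h z :> G z"
    and osl: "\<And>y z. inner (G y - G z) (y - z) \<le> L * (norm (y - z))\<^sup>2"
  shows "h (x + d) \<le> h x + inner (G x) d + L / 2 * (norm d)\<^sup>2"
proof -
  define q where "q s = s * inner (G x) d + L / 2 * s\<^sup>2 * (norm d)\<^sup>2" for s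
  have q: "(q has_real_derivative inner (G x) d + L * s * (norm d)\<^sup>2) (at s)" for s
    unfolding q_def by (auto intro!: derivative_eq_intros)
  have "\<exists>D. ((\<lambda>s. h (x + s *\<^sub>R d) - q s) has_real_derivative D) (at s) \<and> D \<le> 0" if "0 \<le> s" for s
  proof (intro exI conjI)
    show "((\<lambda>s. h (x + s *\<^sub>R d) - q s) has_real_derivative
        inner (G (x + s *\<^sub>R d)) d - (inner (G x) d + L * s * (norm d)\<^sup>2)) (at s)"
      by (rule DERIV_diff[OF has_real_derivative_along_line[OF h] q])
    have "s * inner (G (x + s *\<^sub>R d) - G x) d \<le> s * (L * s * (norm d)\<^sup>2)"
      using osl[of "x + s *\<^sub>R d" x] by (simp add: power_mult_distrib power2_eq_square mult_ac)
    then show "inner (G (x + s *\<^sub>R d)) d - (inner (G x) d + L * s * (norm d)\<^sup>2) \<le> 0"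
      using that by (cases "s = 0") (simp_all add: inner_diff_left)
  qed
  then have "h (x + 1 *\<^sub>R d) - q 1 \<le> h (x + 0 *\<^sub>R d) - q 0"
    by (intro DERIV_nonpos_imp_nonincreasing[of 0 1]) auto
  then show ?thesis by (simp add: q_def)
qed

text \<open>By the quadratic upper bound, the step \<open>- G x / L\<close> decreases \<open>h\<close> by at least
  \<open>(norm (G x))\<^sup>2 / (2 L)\<close>, so this is at most \<open>h x - h x_star\<close>. The lower bound from \<open>x\<close> towards
  \<open>x_star\<close> estimates \<open>h x - h x_star\<close> in turn by the inner product of \<open>G x\<close> and \<open>x - x_star\<close>. Strong
  monotonicity and the Lipschitz bound alone give a contraction only for \<open>\<eta> < 2 \<mu> / L\<^sup>2\<close>; that \<open>G\<close> is
  a gradient extends the range to \<open>1 / L\<close>.\<close>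

lemma gradient_step_contracts:
  fixes h :: "'a::euclidean_space \<Rightarrow> real"
  assumes h: "\<And>z. GDERIV h z :> G z"
    and mono: "\<And>y z. \<mu> * (norm (y - z))\<^sup>2 \<le> inner (G y - G z) (y - z)"
    and lip: "\<And>y z. norm (G y - G z) \<le> L * norm (y - z)"
    and min: "\<And>y. h x_star \<le> h y"
    and L: "0 < L" and \<eta>: "0 < \<eta>" "\<eta> \<le> 1 / L"
  shows "(norm (x - \<eta> *\<^sub>R G x - x_star))\<^sup>2 \<le> (1 - \<eta> * \<mu>) * (norm (x - x_star))\<^sup>2"
proof -
  let ?e = "x - x_star" and ?g = "G x"
  have "inner (G y - G z) (y - z) \<le> L * (norm (y - z))\<^sup>2" for y z
  proof -
    have "inner (G y - G z) (y - z) \<le> norm (G y - G z) * norm (y - z)" by (rule norm_cauchy_schwarz)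
    also have "\<dots> \<le> L * norm (y - z) * norm (y - z)" by (rule mult_right_mono[OF lip norm_ge_zero])
    finally show ?thesis by (simp add: power2_eq_square mult.assoc)
  qed
  note upper = quadratic_upper_bound[of h G L, OF h this]
  have "GDERIV (\<lambda>z. - h z) z :> - G z" for z by (rule GDERIV_minus[OF h])
  moreover have "inner (- G y - - G z) (y - z) \<le> - \<mu> * (norm (y - z))\<^sup>2" for y z
    using mono[of y z] by (simp add: inner_diff_left)
  ultimately have lower: "- h (y + d) \<le> - h y + inner (- G y) d + - \<mu> / 2 * (norm d)\<^sup>2" for y d
    by (rule quadratic_upper_bound)
  have quad: "inner ?g ((- (1 / L)) *\<^sub>R ?g) = - ((norm ?g)\<^sup>2 / L)"
    "L / 2 * (norm ((- (1 / L)) *\<^sub>R ?g))\<^sup>2 = (norm ?g)\<^sup>2 / L / 2"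
    using L by (simp add: power2_norm_eq_inner) (use L in \<open>simp add: power_mult_distrib power2_eq_square\<close>)
  (* The displacement - g / L minimises the quadratic upper bound at x. *)
  have "h x_star \<le> h (x + (- (1 / L)) *\<^sub>R ?g)" by (rule min)
  also have "\<dots> \<le> h x - (norm ?g)\<^sup>2 / L / 2"
    using upper[of x "(- (1 / L)) *\<^sub>R ?g"] unfolding quad by simp
  finally have up: "(norm ?g)\<^sup>2 / L / 2 \<le> h x - h x_star" by simp
  have low: "h x - inner ?g ?e + \<mu> / 2 * (norm ?e)\<^sup>2 \<le> h x_star"
    using lower[of x "x_star - x"] by (simp add: inner_diff_right norm_minus_commute)
  have "(norm ?g)\<^sup>2 / L \<le> 2 * inner ?g ?e - \<mu> * (norm ?e)\<^sup>2" using up low by simp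
  moreover have "\<eta> * (norm ?g)\<^sup>2 \<le> (norm ?g)\<^sup>2 / L"
    using mult_right_mono[OF \<eta>(2), of "(norm ?g)\<^sup>2"] by simp
  ultimately have "\<eta> * (norm ?g)\<^sup>2 \<le> 2 * inner ?g ?e - \<mu> * (norm ?e)\<^sup>2" by linarith
  then have "\<eta> * (\<eta> * (norm ?g)\<^sup>2) \<le> \<eta> * (2 * inner ?g ?e - \<mu> * (norm ?e)\<^sup>2)"
    using \<eta>(1) by (intro mult_left_mono) auto
  also have "\<dots> = 2 * (\<eta> * inner ?g ?e) - \<eta> * \<mu> * (norm ?e)\<^sup>2" by (simp add: right_diff_distrib)
  finally have gain: "\<eta> * (\<eta> * (norm ?g)\<^sup>2) \<le> 2 * (\<eta> * inner ?g ?e) - \<eta> * \<mu> * (norm ?e)\<^sup>2" .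
  have expand: "(norm (a - b))\<^sup>2 = (norm a)\<^sup>2 + (norm b)\<^sup>2 - 2 * inner a b" for a b :: 'a
    by (simp add: power2_norm_eq_inner inner_simps inner_commute)
  have "x - \<eta> *\<^sub>R ?g - x_star = ?e - \<eta> *\<^sub>R ?g" by simp
  then have "(norm (x - \<eta> *\<^sub>R ?g - x_star))\<^sup>2 = (norm (?e - \<eta> *\<^sub>R ?g))\<^sup>2"
    by (rule arg_cong)
  also have "\<dots> = (norm ?e)\<^sup>2 + (norm (\<eta> *\<^sub>R ?g))\<^sup>2 - 2 * inner ?e (\<eta> *\<^sub>R ?g)"
    by (rule expand)
  also have "inner ?e (\<eta> *\<^sub>R ?g) = \<eta> * inner ?g ?e" by (simp only: inner_scaleR_right inner_commute)
  also have "(norm (\<eta> *\<^sub>R ?g))\<^sup>2 = \<eta> * (\<eta> * (norm ?g)\<^sup>2)"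
    using \<eta>(1) by (simp add: power2_eq_square)
  finally show ?thesis using gain by (simp only: left_diff_distrib mult_1)
qed

section \<open>Consensus under powers of a stochastic matrix\<close>

lemma geometric_of_block_contraction:
  fixes v :: "nat \<Rightarrow> real"
  assumes block: "\<And>t. v (t + m) \<le> q * v t" and mono: "\<And>t. v (Suc t) \<le> v t"
    and pos: "\<And>t. 0 \<le> v t" and q: "q < 1" and m: "0 < m"
  shows "\<exists>C \<sigma>. 0 \<le> C \<and> 0 < \<sigma> \<and> \<sigma> < 1 \<and> (\<forall>t. v t \<le> C * \<sigma> ^ t)"
proof -
  (* q may be zero or negative, but the m-th root below must be positive. *)
  define q' where "q' = max q (1 / 2)"
  have q': "0 < q'" "q' < 1" "q \<le> q'" using q by (auto simp: q'_def)
  define \<sigma> where "\<sigma> = root m q'"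
  have \<sigma>: "0 < \<sigma>" "\<sigma> < 1" "\<sigma> ^ m = q'"
    using q' m by (simp_all add: \<sigma>_def real_root_lt_1_iff)
  define C where "C = v 0 / q'"
  have "v t \<le> C * \<sigma> ^ t" for t
  proof (induction t rule: less_induct)
    case (less t)
    show ?case
    proof (cases "t < m")
      case True
      have "q' \<le> \<sigma> ^ t" using \<sigma> True by (metis less_imp_le power_decreasing)
      then have "C * q' \<le> C * \<sigma> ^ t" using pos q' by (intro mult_left_mono) (auto simp: C_def)
      moreover have "v t \<le> v 0" using lift_Suc_antimono_le[of v 0 t] mono by simp
      ultimately show ?thesis using q' by (simp add: C_def)
    next
      case False
      have "v t \<le> q * v (t - m)" using block[of "t - m"] False by simp
      also have "\<dots> \<le> q' * v (t - m)" by (intro mult_right_mono q' pos)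
      also have "\<dots> \<le> \<sigma> ^ m * (C * \<sigma> ^ (t - m))"
        using less[of "t - m"] False m q' \<sigma> by (simp add: mult_left_mono)
      also have "\<dots> = C * \<sigma> ^ t" using False by (simp flip: power_add)
      finally show ?thesis .
    qed
  qed
  with \<sigma> pos[of 0] q' show ?thesis by (intro exI[of _ C] exI[of _ \<sigma>]) (auto simp: C_def)
qed

lemma geometric_of_perturbed_contraction:
  fixes a :: "nat \<Rightarrow> real"
  assumes step: "\<And>t. a (Suc t) \<le> \<rho> * a t + K * \<sigma> ^ t"
    and "0 \<le> a 0" and "0 \<le> K" and \<rho>: "0 \<le> \<rho>" "\<rho> < 1" and \<sigma>: "0 < \<sigma>" "\<sigma> < 1"
  shows "\<exists>C \<tau>. 0 \<le> C \<and> \<sigma> \<le> \<tau> \<and> \<tau> < 1 \<and> (\<forall>t. a t \<le> C * \<tau> ^ t)"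
proof -
  obtain \<tau> where \<tau>: "max \<rho> \<sigma> < \<tau>" "\<tau> < 1" using dense[of "max \<rho> \<sigma>" 1] \<rho> \<sigma> by auto
  (* This C dominates the initial value and makes the perturbation fit into the gap tau - rho. *)
  define C where "C = a 0 + K / (\<tau> - \<rho>)"
  have gap: "0 < \<tau> - \<rho>" using \<tau> by simp
  then have C: "0 \<le> C" "a 0 \<le> C" using assms(2,3) by (simp_all add: C_def)
  have "(\<tau> - \<rho>) * C = (\<tau> - \<rho>) * a 0 + K" using gap by (simp add: C_def distrib_left)
  then have K: "K \<le> (\<tau> - \<rho>) * C" using mult_nonneg_nonneg[of "\<tau> - \<rho>" "a 0"] gap assms(2) by linarith
  have "a t \<le> C * \<tau> ^ t" for t
  proof (induction t)
    case 0
    show ?case using C by simp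
  next
    case (Suc t)
    have "a (Suc t) \<le> \<rho> * a t + K * \<sigma> ^ t" by (rule step)
    also have "\<dots> \<le> \<rho> * (C * \<tau> ^ t) + ((\<tau> - \<rho>) * C) * \<tau> ^ t"
    proof (rule add_mono)
      show "\<rho> * a t \<le> \<rho> * (C * \<tau> ^ t)" using Suc \<rho>(1) by (rule mult_left_mono)
      have "\<sigma> ^ t \<le> \<tau> ^ t" using \<sigma> \<tau> by (intro power_mono) auto
      then show "K * \<sigma> ^ t \<le> ((\<tau> - \<rho>) * C) * \<tau> ^ t"
        using K assms(3) \<sigma> by (intro mult_mono) auto
    qed
    also have "\<dots> = C * \<tau> ^ Suc t" by (simp add: algebra_simps)
    finally show ?case .
  qed
  with C \<tau> show ?thesis by (intro exI[of _ C] exI[of _ \<tau>]) auto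
qed

definition row_stochastic :: "real^'n^'n \<Rightarrow> bool" where
  "row_stochastic B \<longleftrightarrow> (\<forall>i j. 0 \<le> B $ i $ j) \<and> (\<forall>i. (\<Sum>j\<in>UNIV. B $ i $ j) = 1)"

lemma row_stochastic_mult:
  fixes A B :: "real^'n::finite^'n"
  assumes "row_stochastic A" "row_stochastic B"
  shows "row_stochastic (A ** B)"
proof -
  have "(\<Sum>j\<in>UNIV. (A ** B) $ i $ j) = (\<Sum>k\<in>UNIV. A $ i $ k * (\<Sum>j\<in>UNIV. B $ k $ j))" for i
    by (simp add: matrix_matrix_mult_def sum_distrib_left) (rule sum.swap)
  then show ?thesis
    using assms by (auto simp: row_stochastic_def matrix_matrix_mult_def intro!: sum_nonneg)
qed

lemma row_stochastic_matpow:
  fixes A :: "real^'n::finite^'n"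
  assumes "row_stochastic A"
  shows "row_stochastic (matpow A m)"
proof (induction m)
  case 0
  show ?case by (auto simp: row_stochastic_def Finite_Cartesian_Product.mat_def)
next
  case (Suc m)
  then show ?case using assms by (simp add: row_stochastic_mult)
qed

definition spread :: "'a::real_normed_vector^'n::finite \<Rightarrow> real" where
  "spread x = Max (range (\<lambda>(i, k). norm (x $ i - x $ k)))"

lemma norm_diff_le_spread: "norm (x $ i - x $ k) \<le> spread x"
  unfolding spread_def by (rule Max_ge) (auto intro: range_eqI[of _ _ "(i, k)"])

lemma spread_le_iff: "spread x \<le> c \<longleftrightarrow> (\<forall>i k. norm (x $ i - x $ k) \<le> c)"
  unfolding spread_def by (subst Max_le_iff) auto

lemma spread_nonneg: "0 \<le> spread x"
  using norm_diff_le_spread[of x undefined undefined] by simp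

text \<open>A difference \<open>z $ i - z $ k\<close> of two averages is the double average of all differences. The term in which both
  select the common positive column vanishes, and this accounts for the factor below \<open>1\<close>.\<close>

lemma spread_average_le:
  fixes x z :: "'a::real_normed_vector^'n::finite"
  assumes B: "row_stochastic B" and \<delta>: "0 \<le> \<delta>" "\<And>i. \<delta> \<le> B $ i $ j"
    and z: "\<And>i. z $ i = (\<Sum>a\<in>UNIV. B $ i $ a *\<^sub>R x $ a) - c"
  shows "spread z \<le> (1 - \<delta>\<^sup>2) * spread x"
  unfolding spread_le_iff
proof (intro allI)
  fix i k
  let ?V = "spread x"
  have pos: "0 \<le> B $ i $ a" and sum1: "(\<Sum>a\<in>UNIV. B $ i $ a) = 1" for i a
    using B by (simp_all add: row_stochastic_def)
  have l: "(\<Sum>a\<in>UNIV. \<Sum>b\<in>UNIV. (B $ i $ a * B $ k $ b) *\<^sub>R x $ a) = (\<Sum>a\<in>UNIV. B $ i $ a *\<^sub>R x $ a)"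
    by (simp add: sum1 flip: scaleR_sum_left sum_distrib_left)
  have "(\<Sum>a\<in>UNIV. \<Sum>b\<in>UNIV. (B $ i $ a * B $ k $ b) *\<^sub>R x $ b)
      = (\<Sum>b\<in>UNIV. (\<Sum>a\<in>UNIV. B $ i $ a * B $ k $ b) *\<^sub>R x $ b)"
    by (subst sum.swap) (simp add: scaleR_sum_left)
  then have r: "(\<Sum>a\<in>UNIV. \<Sum>b\<in>UNIV. (B $ i $ a * B $ k $ b) *\<^sub>R x $ b) = (\<Sum>b\<in>UNIV. B $ k $ b *\<^sub>R x $ b)"
    by (simp add: sum1 flip: sum_distrib_right)
  have "z $ i - z $ k = (\<Sum>a\<in>UNIV. \<Sum>b\<in>UNIV. (B $ i $ a * B $ k $ b) *\<^sub>R (x $ a - x $ b))"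
    by (simp add: z scaleR_diff_right sum_subtractf l r)
  also have "\<dots> = (\<Sum>(a, b)\<in>UNIV. (B $ i $ a * B $ k $ b) *\<^sub>R (x $ a - x $ b))"
    by (simp add: sum.cartesian_product)
  also have "\<dots> = (\<Sum>(a, b)\<in>UNIV - {(j, j)}. (B $ i $ a * B $ k $ b) *\<^sub>R (x $ a - x $ b))"
    by (rule sum.mono_neutral_right) auto
  finally have diff: "z $ i - z $ k
      = (\<Sum>(a, b)\<in>UNIV - {(j, j)}. (B $ i $ a * B $ k $ b) *\<^sub>R (x $ a - x $ b))" .
  have "norm (z $ i - z $ k)
      \<le> (\<Sum>(a, b)\<in>UNIV - {(j, j)}. norm ((B $ i $ a * B $ k $ b) *\<^sub>R (x $ a - x $ b)))"
    unfolding diff case_prod_unfold by (rule norm_sum)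
  also have "\<dots> \<le> (\<Sum>(a, b)\<in>UNIV - {(j, j)}. B $ i $ a * B $ k $ b * ?V)"
    by (intro sum_mono) (auto simp: abs_mult pos intro!: mult_left_mono norm_diff_le_spread)
  also have "\<dots> = (\<Sum>(a, b)\<in>UNIV. B $ i $ a * B $ k $ b * ?V) - B $ i $ j * B $ k $ j * ?V"
    by (simp add: sum_diff1)
  also have "(\<Sum>(a, b)\<in>UNIV. B $ i $ a * B $ k $ b * ?V) = ?V"
  proof -
    have "(\<Sum>(a, b)\<in>UNIV. B $ i $ a * B $ k $ b * ?V) = (\<Sum>a\<in>UNIV. \<Sum>b\<in>UNIV. B $ i $ a * B $ k $ b * ?V)"
      by (simp add: sum.cartesian_product)
    also have "\<dots> = ?V" by (simp add: sum1 flip: sum_distrib_right sum_distrib_left)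
    finally show ?thesis .
  qed
  also have "?V - B $ i $ j * B $ k $ j * ?V \<le> (1 - \<delta>\<^sup>2) * ?V"
    using mult_right_mono[OF mult_mono[OF \<delta>(2)[of i] \<delta>(2)[of k]] spread_nonneg, of x] pos \<delta>(1)
    by (simp add: power2_eq_square algebra_simps)
  finally show "norm (z $ i - z $ k) \<le> (1 - \<delta>\<^sup>2) * ?V" .
qed

text \<open>Averaging keeps a positive column positive. Passing to the next power makes the exponent positive,
  so that a block of that length is a genuine step.\<close>

lemma SIA_positive_power:
  fixes A :: "real^'n::finite^'n"
  assumes "row_stochastic A" and "SIA A"
  shows "\<exists>m j \<delta>. 0 < m \<and> 0 < \<delta> \<and> (\<forall>i. \<delta> \<le> matpow A m $ i $ j)"
proof -
  obtain m j where mj: "\<And>i. 0 < matpow A m $ i $ j" using assms(2) by (auto simp: SIA_def)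
  define \<delta> where "\<delta> = Min (range (\<lambda>i. matpow A m $ i $ j))"
  have "\<delta> \<in> range (\<lambda>i. matpow A m $ i $ j)" unfolding \<delta>_def by (rule Min_in) auto
  then have "0 < \<delta>" using mj by auto
  have le: "\<delta> \<le> matpow A m $ i $ j" for i by (simp add: \<delta>_def)
  have "\<delta> \<le> matpow A (Suc m) $ i $ j" for i
  proof -
    have "\<delta> = (\<Sum>k\<in>UNIV. A $ i $ k * \<delta>)"
      using assms(1) by (simp add: row_stochastic_def flip: sum_distrib_right)
    also have "\<dots> \<le> (\<Sum>k\<in>UNIV. A $ i $ k * matpow A m $ k $ j)"
      using assms(1) le by (intro sum_mono mult_left_mono) (auto simp: row_stochastic_def)
    finally show ?thesis by (simp add: matrix_matrix_mult_def)
  qed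
  with \<open>0 < \<delta>\<close> show ?thesis by (intro exI[of _ "Suc m"] exI[of _ j] exI[of _ \<delta>]) simp
qed

text \<open>An input common to all nodes stays common under row-stochastic mixing, so it cancels in the
  differences between nodes.\<close>

lemma common_input_unroll:
  fixes x :: "nat \<Rightarrow> 'a::real_normed_vector^'n::finite"
  assumes A: "row_stochastic A"
    and x: "\<And>t i. x (Suc t) $ i = (\<Sum>a\<in>UNIV. A $ i $ a *\<^sub>R x t $ a) - y t"
  shows "\<exists>c. \<forall>i. x (t + m) $ i = (\<Sum>a\<in>UNIV. matpow A m $ i $ a *\<^sub>R x t $ a) - c"
proof (induction m)
  case 0
  have "(\<Sum>a\<in>UNIV. matpow A 0 $ i $ a *\<^sub>R x t $ a) = x t $ i" for i
    by (simp add: Finite_Cartesian_Product.mat_def if_distrib[of "\<lambda>x. x *\<^sub>R _"] cong: if_cong)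
  then show ?case by auto
next
  case (Suc m)
  then obtain c where c: "\<And>i. x (t + m) $ i = (\<Sum>a\<in>UNIV. matpow A m $ i $ a *\<^sub>R x t $ a) - c" by blast
  have "x (t + Suc m) $ i = (\<Sum>a\<in>UNIV. matpow A (Suc m) $ i $ a *\<^sub>R x t $ a) - (c + y (t + m))" for i
  proof -
    have "(\<Sum>k\<in>UNIV. A $ i $ k *\<^sub>R (\<Sum>a\<in>UNIV. matpow A m $ k $ a *\<^sub>R x t $ a))
        = (\<Sum>a\<in>UNIV. matpow A (Suc m) $ i $ a *\<^sub>R x t $ a)"
      by (simp add: matrix_matrix_mult_def scaleR_sum_right scaleR_sum_left) (rule sum.swap)
    moreover have "(\<Sum>k\<in>UNIV. A $ i $ k *\<^sub>R c) = c"
      using A by (simp add: row_stochastic_def flip: scaleR_sum_left)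
    ultimately show ?thesis
      by (simp add: x c scaleR_diff_right sum_subtractf)
  qed
  then show ?case by blast
qed

lemma spread_geometric:
  fixes x :: "nat \<Rightarrow> 'a::real_normed_vector^'n::finite"
  assumes A: "row_stochastic A" "SIA A"
    and x: "\<And>t i. x (Suc t) $ i = (\<Sum>a\<in>UNIV. A $ i $ a *\<^sub>R x t $ a) - y t"
  shows "\<exists>C \<sigma>. 0 \<le> C \<and> 0 < \<sigma> \<and> \<sigma> < 1 \<and> (\<forall>t. spread (x t) \<le> C * \<sigma> ^ t)"
proof -
  obtain m j \<delta> where m: "0 < m" "0 < \<delta>" "\<forall>i. \<delta> \<le> matpow A m $ i $ j"
    using SIA_positive_power[OF A] by (elim exE conjE)
  show ?thesis
  proof (rule geometric_of_block_contraction)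
    show "0 < m" "1 - \<delta>\<^sup>2 < 1" using m by simp_all
    show "spread (x (t + m)) \<le> (1 - \<delta>\<^sup>2) * spread (x t)" for t
    proof -
      obtain c where c: "\<forall>i. x (t + m) $ i = (\<Sum>a\<in>UNIV. matpow A m $ i $ a *\<^sub>R x t $ a) - c"
        using common_input_unroll[of A x y t m, OF A(1) x] by (rule exE)
      show ?thesis
      proof (rule spread_average_le)
        show "row_stochastic (matpow A m)" by (rule row_stochastic_matpow[OF A(1)])
        show "x (t + m) $ i = (\<Sum>a\<in>UNIV. matpow A m $ i $ a *\<^sub>R x t $ a) - c" for i
          using c by (rule spec)
        show "0 \<le> \<delta>" using m(2) by simp
        show "\<delta> \<le> matpow A m $ i $ j" for i using m(3) by (rule spec)
      qed
    qed
    show "spread (x (Suc t)) \<le> spread (x t)" for t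
    proof -
      (* With \<delta> = 0 any column serves. *)
      have "spread (x (Suc t)) \<le> (1 - 0\<^sup>2) * spread (x t)"
        by (rule spread_average_le[where j = undefined, OF A(1) order_refl _ x])
          (use A(1) in \<open>simp add: row_stochastic_def\<close>)
      then show ?thesis by simp
    qed
  qed (rule spread_nonneg)
qed

section \<open>Linear convergence\<close>

lemma GDERIV_sum:
  assumes "\<And>i. GDERIV (f i) z :> g i z"
  shows "GDERIV (\<lambda>z. c * (\<Sum>i\<in>S. f i z)) z :> c *\<^sub>R (\<Sum>i\<in>S. g i z)"
proof -
  have "((\<lambda>z. c * (\<Sum>i\<in>S. f i z)) has_derivative (\<lambda>h. c * (\<Sum>i\<in>S. inner h (g i z)))) (at z)"
    by (rule has_derivative_mult_right, rule has_derivative_sum, rule assms[unfolded gderiv_def])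
  then show ?thesis by (simp add: gderiv_def inner_sum_right)
qed

text \<open>The iterate of any one node follows the gradient descent of the average \<open>h\<close> of the \<open>f i\<close>, up to an
  error that is controlled by the spread: mixing moves the node by at most the spread, and evaluating
  the gradients at the iterates of the other nodes costs at most \<open>\<eta> * L\<close> times the spread. The spread decays
  geometrically on its own, and the descent step contracts.
  A single node replaces the plain average of the iterates as reference point, because mixing with a
  matrix that is only row-stochastic moves that average.\<close>

lemma average_gradient_descent_linear:
  fixes f :: "'n::finite \<Rightarrow> 'a::euclidean_space \<Rightarrow> real" and x :: "nat \<Rightarrow> 'a^'n"
  assumes f: "\<And>i z. GDERIV (f i) z :> g i z"
    and \<mu>: "0 < \<mu>" and L: "0 < L"
    and mono: "\<And>i y z. \<mu> * (norm (y - z))\<^sup>2 \<le> inner (g i y - g i z) (y - z)"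
    and lip: "\<And>i y z. norm (g i y - g i z) \<le> L * norm (y - z)"
    and min: "\<And>y. (\<Sum>i\<in>UNIV. f i x_star) \<le> (\<Sum>i\<in>UNIV. f i y)"
    and A: "row_stochastic A" "SIA A" and \<eta>: "0 < \<eta>" "\<eta> < 1 / (\<mu> + L)"
    and x: "\<And>t i. x (Suc t) $ i = (\<Sum>a\<in>UNIV. A $ i $ a *\<^sub>R x t $ a)
              - \<eta> *\<^sub>R (1 / real CARD('n)) *\<^sub>R (\<Sum>k\<in>UNIV. g k (x t $ k))"
  shows "\<exists>C \<tau>. 0 \<le> C \<and> 0 < \<tau> \<and> \<tau> < 1 \<and> (\<forall>t. norm (x t - (\<chi> i. x_star)) \<le> C * \<tau> ^ t)"
proof -
  define n where "n = real CARD('n)"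
  have n: "0 < n" by (simp add: n_def)
  define G where "G z = (1 / n) *\<^sub>R (\<Sum>i\<in>UNIV. g i z)" for z
  define h where "h z = 1 / n * (\<Sum>i\<in>UNIV. f i z)" for z
  have h: "GDERIV h z :> G z" for z
    unfolding h_def G_def by (rule GDERIV_sum) (rule f)
  have G_mono: "\<mu> * (norm (y - z))\<^sup>2 \<le> inner (G y - G z) (y - z)" for y z
  proof -
    have "n * (\<mu> * (norm (y - z))\<^sup>2) \<le> (\<Sum>i\<in>UNIV. inner (g i y - g i z) (y - z))"
      unfolding n_def by (rule sum_bounded_below) (rule mono)
    then show ?thesis
      using n by (simp add: G_def inner_sum_left sum_subtractf inner_diff_left field_simps)
  qed
  have average_norm: "norm ((1 / n) *\<^sub>R (\<Sum>i\<in>UNIV. u i)) \<le> c" if "\<And>i. norm (u i) \<le> c"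
    for u :: "'n \<Rightarrow> 'a" and c
  proof -
    have "norm (\<Sum>i\<in>UNIV. u i) \<le> n * c"
      unfolding n_def by (rule order_trans[OF norm_sum]) (rule sum_bounded_above, rule that)
    then show ?thesis using n by (simp add: field_simps)
  qed
  have G_lip: "norm (G y - G z) \<le> L * norm (y - z)" for y z
    using average_norm[of "\<lambda>i. g i y - g i z", OF lip]
    by (simp add: G_def sum_subtractf flip: scaleR_diff_right)
  have h_min: "h x_star \<le> h y" for y
    using min n by (simp add: h_def divide_right_mono)
  have "\<eta> * (\<mu> + L) < 1" using \<eta>(2) \<mu> L by (simp add: field_simps)
  then have step: "\<eta> * \<mu> < 1" "\<eta> * L \<le> 1"
    using mult_pos_pos[OF \<eta>(1) \<mu>] mult_pos_pos[OF \<eta>(1) L] by (simp_all add: distrib_left)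
  define \<rho> where "\<rho> = sqrt (1 - \<eta> * \<mu>)"
  have \<rho>: "0 \<le> \<rho>" "\<rho> < 1" using step mult_pos_pos[OF \<eta>(1) \<mu>] by (auto simp: \<rho>_def)
  have contract: "norm (z - \<eta> *\<^sub>R G z - x_star) \<le> \<rho> * norm (z - x_star)" for z
  proof -
    have "(norm (z - \<eta> *\<^sub>R G z - x_star))\<^sup>2 \<le> (1 - \<eta> * \<mu>) * (norm (z - x_star))\<^sup>2"
      by (rule gradient_step_contracts[OF h G_mono G_lip h_min L \<eta>(1)])
        (use step L in \<open>simp add: field_simps\<close>)
    then have "norm (z - \<eta> *\<^sub>R G z - x_star) \<le> sqrt ((1 - \<eta> * \<mu>) * (norm (z - x_star))\<^sup>2)"
      by (rule real_le_rsqrt)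
    then show ?thesis by (simp add: \<rho>_def real_sqrt_mult)
  qed
  define y where "y t = \<eta> *\<^sub>R (1 / n) *\<^sub>R (\<Sum>k\<in>UNIV. g k (x t $ k))" for t
  have x': "x (Suc t) $ i = (\<Sum>a\<in>UNIV. A $ i $ a *\<^sub>R x t $ a) - y t" for t i
    by (simp only: x y_def n_def)
  obtain C\<^sub>1 \<sigma> where C\<^sub>1: "0 \<le> C\<^sub>1" "0 < \<sigma>" "\<sigma> < 1" "\<And>t. spread (x t) \<le> C\<^sub>1 * \<sigma> ^ t"
    using spread_geometric[of A x y, OF A x'] by (elim exE conjE) (rule that, auto)
  (* The reference node. *)
  fix k0 :: 'n
  let ?u = "\<lambda>t. x t $ k0"
  have near: "norm (?u (Suc t) - (?u t - \<eta> *\<^sub>R G (?u t))) \<le> (1 + \<eta> * L) * spread (x t)" for t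
  proof -
    let ?V = "spread (x t)"
    have "(\<Sum>a\<in>UNIV. A $ k0 $ a *\<^sub>R ?u t) = ?u t"
      using A(1) by (simp add: row_stochastic_def flip: scaleR_sum_left)
    then have decomp: "?u (Suc t) - (?u t - \<eta> *\<^sub>R G (?u t))
      = (\<Sum>a\<in>UNIV. A $ k0 $ a *\<^sub>R (x t $ a - ?u t))
        - \<eta> *\<^sub>R (1 / n) *\<^sub>R (\<Sum>k\<in>UNIV. g k (x t $ k) - g k (?u t))"
      by (simp add: x' y_def G_def scaleR_diff_right sum_subtractf)
    have mix: "norm (\<Sum>a\<in>UNIV. A $ k0 $ a *\<^sub>R (x t $ a - ?u t)) \<le> ?V"
    proof -
      have "norm (\<Sum>a\<in>UNIV. A $ k0 $ a *\<^sub>R (x t $ a - ?u t)) \<le> (\<Sum>a\<in>UNIV. A $ k0 $ a * ?V)"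
        using A(1) by (intro sum_norm_le)
          (auto simp: row_stochastic_def intro!: mult_left_mono norm_diff_le_spread)
      also have "\<dots> = ?V" using A(1) by (simp add: row_stochastic_def flip: sum_distrib_right)
      finally show ?thesis .
    qed
    have grad: "norm (\<eta> *\<^sub>R (1 / n) *\<^sub>R (\<Sum>k\<in>UNIV. g k (x t $ k) - g k (?u t))) \<le> \<eta> * (L * ?V)"
    proof -
      have "norm (g k (x t $ k) - g k (?u t)) \<le> L * ?V" for k
        by (rule order_trans[OF lip]) (use L in \<open>simp add: mult_left_mono norm_diff_le_spread\<close>)
      from average_norm[OF this] show ?thesis
        unfolding norm_scaleR[of \<eta>] using \<eta>(1) by (simp add: mult_left_mono del: norm_scaleR)
    qed
    have "norm (?u (Suc t) - (?u t - \<eta> *\<^sub>R G (?u t))) \<le> ?V + \<eta> * (L * ?V)"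
      unfolding decomp by (rule order_trans[OF norm_triangle_ineq4 add_mono[OF mix grad]])
    then show ?thesis by (simp add: distrib_right mult.assoc)
  qed
  have recursion: "norm (?u (Suc t) - x_star) \<le> \<rho> * norm (?u t - x_star) + ((1 + \<eta> * L) * C\<^sub>1) * \<sigma> ^ t" for t
  proof -
    have "norm (?u (Suc t) - x_star) \<le> norm (?u t - \<eta> *\<^sub>R G (?u t) - x_star)
        + norm (?u (Suc t) - (?u t - \<eta> *\<^sub>R G (?u t)))"
      using norm_triangle_ineq[of "?u t - \<eta> *\<^sub>R G (?u t) - x_star" "?u (Suc t) - (?u t - \<eta> *\<^sub>R G (?u t))"]
      by simp
    also have "\<dots> \<le> \<rho> * norm (?u t - x_star) + (1 + \<eta> * L) * spread (x t)"
      by (intro add_mono contract near)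
    also have "\<dots> \<le> \<rho> * norm (?u t - x_star) + (1 + \<eta> * L) * (C\<^sub>1 * \<sigma> ^ t)"
      using C\<^sub>1 L \<eta> by (intro add_left_mono mult_left_mono) auto
    finally show ?thesis by (simp add: mult.assoc)
  qed
  have "0 \<le> (1 + \<eta> * L) * C\<^sub>1" using C\<^sub>1(1) L \<eta>(1) by simp
  from geometric_of_perturbed_contraction[of "\<lambda>t. norm (?u t - x_star)", OF recursion norm_ge_zero this \<rho> C\<^sub>1(2,3)]
  obtain C\<^sub>2 \<tau> where C\<^sub>2: "0 \<le> C\<^sub>2" "\<sigma> \<le> \<tau>" "\<tau> < 1" "\<forall>t. norm (?u t - x_star) \<le> C\<^sub>2 * \<tau> ^ t"
    by (elim exE conjE)
  have "norm (x t - (\<chi> i. x_star)) \<le> (n * (C\<^sub>1 + C\<^sub>2)) * \<tau> ^ t" for t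
  proof -
    have "norm (x t - (\<chi> i. x_star)) \<le> (\<Sum>i\<in>UNIV. norm ((x t - (\<chi> i. x_star)) $ i))"
      unfolding norm_vec_def by (rule L2_set_le_sum) simp
    also have "\<dots> \<le> n * ((C\<^sub>1 + C\<^sub>2) * \<tau> ^ t)"
      unfolding n_def
    proof (rule sum_bounded_above)
      fix i
      have "norm (x t $ i - x_star) \<le> norm (x t $ i - ?u t) + norm (?u t - x_star)"
        using norm_triangle_ineq[of "x t $ i - ?u t" "?u t - x_star"] by simp
      also have "\<dots> \<le> C\<^sub>1 * \<tau> ^ t + C\<^sub>2 * \<tau> ^ t"
      proof (rule add_mono)
        show "norm (?u t - x_star) \<le> C\<^sub>2 * \<tau> ^ t" using C\<^sub>2(4) by (rule spec)
        have "norm (x t $ i - ?u t) \<le> C\<^sub>1 * \<sigma> ^ t"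
          by (rule order_trans[OF norm_diff_le_spread C\<^sub>1(4)])
        also have "\<dots> \<le> C\<^sub>1 * \<tau> ^ t" using C\<^sub>1 C\<^sub>2 by (intro mult_left_mono power_mono) auto
        finally show "norm (x t $ i - ?u t) \<le> C\<^sub>1 * \<tau> ^ t" .
      qed
      finally show "norm ((x t - (\<chi> i. x_star)) $ i) \<le> (C\<^sub>1 + C\<^sub>2) * \<tau> ^ t"
        by (simp add: distrib_right)
    qed
    finally show ?thesis by simp
  qed
  with C\<^sub>1 C\<^sub>2 n show ?thesis
    by (intro exI[of _ "n * (C\<^sub>1 + C\<^sub>2)"] exI[of _ \<tau>]) auto
qed

section \<open>Exact averages and linear convergence\<close>

theorem theorem1:
  fixes E :: "('n::finite) rel"
    and f :: "'n \<Rightarrow> real^('p::finite) \<Rightarrow> real"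
    and g :: "'n \<Rightarrow> real^'p \<Rightarrow> real^'p"
    and \<mu> L :: real
    and x_star :: "real^'p"
  assumes "strongly_connected_digraph E"
    and "\<And>i x. GDERIV (f i) x :> g i x"
    and "0 < \<mu>" and "0 < L"
    and "\<And>i x y. inner (g i x - g i y) (x - y) \<ge> \<mu> * (norm (x - y))\<^sup>2"
    and "\<And>i x y. norm (g i x - g i y) \<le> L * norm (x - y)"
    and "\<And>x. (\<Sum>i\<in>UNIV. f i x_star) \<le> (\<Sum>i\<in>UNIV. f i x)"
  shows "(\<forall>(s :: nat \<Rightarrow> 'n \<Rightarrow> real) Rs b.
            prftps_execution E s Rs b \<and> non_exceptional E b \<longrightarrow>
            (\<forall>t j. prftps E Rs b t j = Some ((\<Sum>i\<in>UNIV. s t i) / real CARD('n)))) \<and>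
         (\<forall>(A :: real^'n^'n) \<eta> x Rs b.
            row_stochastic_on E A \<and> SIA A \<and> 0 < \<eta> \<and> \<eta> < 1 / (\<mu> + L) \<and>
            prftps_gd E g A \<eta> x Rs b \<and> (\<forall>c. non_exceptional E (b c)) \<longrightarrow>
            (\<exists>C \<rho>. 0 \<le> C \<and> 0 < \<rho> \<and> \<rho> < 1 \<and>
               (\<forall>t. norm (x t - (\<chi> i. x_star)) \<le> C * \<rho> ^ t)))"
proof (rule conjI)
  show "\<forall>(s :: nat \<Rightarrow> 'n \<Rightarrow> real) Rs b.
      prftps_execution E s Rs b \<and> non_exceptional E b \<longrightarrow>
      (\<forall>t j. prftps E Rs b t j = Some ((\<Sum>i\<in>UNIV. s t i) / real CARD('n)))"
    using prftps_eq_average[OF assms(1)] by blast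
next
  show "\<forall>(A :: real^'n^'n) \<eta> x Rs b.
      row_stochastic_on E A \<and> SIA A \<and> 0 < \<eta> \<and> \<eta> < 1 / (\<mu> + L) \<and>
      prftps_gd E g A \<eta> x Rs b \<and> (\<forall>c. non_exceptional E (b c)) \<longrightarrow>
      (\<exists>C \<rho>. 0 \<le> C \<and> 0 < \<rho> \<and> \<rho> < 1 \<and>
         (\<forall>t. norm (x t - (\<chi> i. x_star)) \<le> C * \<rho> ^ t))"
  proof (intro allI impI, elim conjE)
    fix A :: "real^'n^'n" and \<eta> :: real and x Rs b
    assume A: "row_stochastic_on E A" "SIA A" and \<eta>: "0 < \<eta>" "\<eta> < 1 / (\<mu> + L)"
      and gd: "prftps_gd E g A \<eta> x Rs b" and ne: "\<forall>c. non_exceptional E (b c)"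
    (* The second part sees PrFTPS only through the first, applied to each coordinate. *)
    have average: "(\<chi> c. the (prftps E (Rs c) (b c) t i))
        = (1 / real CARD('n)) *\<^sub>R (\<Sum>k\<in>UNIV. g k (x t $ k))" for t i
    proof -
      have "prftps E (Rs c) (b c) t i = Some ((\<Sum>k\<in>UNIV. g k (x t $ k) $ c) / real CARD('n))" for c
        using gd ne by (intro prftps_eq_average[OF assms(1)]) (simp_all add: prftps_gd_def)
      then show ?thesis by (simp add: vec_eq_iff)
    qed
    have mix: "(\<Sum>j\<in>in_nbrs E i \<union> {i}. A $ i $ j *\<^sub>R x t $ j) = (\<Sum>j\<in>UNIV. A $ i $ j *\<^sub>R x t $ j)"
      for i t
      using A(1) by (intro sum.mono_neutral_left) (auto simp: row_stochastic_on_def)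
    have "x (Suc t) $ i = (\<Sum>j\<in>UNIV. A $ i $ j *\<^sub>R x t $ j)
        - \<eta> *\<^sub>R (1 / real CARD('n)) *\<^sub>R (\<Sum>k\<in>UNIV. g k (x t $ k))" for t i
      using gd unfolding prftps_gd_def mix average by blast
    moreover have "row_stochastic A"
      using A(1) by (simp add: row_stochastic_on_def row_stochastic_def)
    ultimately show "\<exists>C \<rho>. 0 \<le> C \<and> 0 < \<rho> \<and> \<rho> < 1 \<and>
        (\<forall>t. norm (x t - (\<chi> i. x_star)) \<le> C * \<rho> ^ t)"
      using average_gradient_descent_linear[of f g \<mu> L x_star A \<eta> x] assms(2-) A(2) \<eta> by blast
  qed
qed

end
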